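(* Fix integers $k,l\ge 0$ with $k+l>0$ and $n\ge 1$. Let $v\in a_{k,l}(n)$ and let $A,B\in I(k,l)$ be any two shuffles. If $v\mapsto (P_A,Q_A)$ under the $A$-RSK and $v\mapsto (P_B,Q_B)$ under the $B$-RSK, then $\mathrm{sh}(P_A)=\mathrm{sh}(P_B)$, and consequently $Q_A=Q_B$.
   Context: Let $t_1,\dots,t_k,u_1,\dots,u_l$ be distinct symbols ("$t$-letters" and "$u$-letters"). A shuffle is a total order $<_A$ on $\{t_1,\dots,t_k,u_1,\dots,u_l\}$ with $t_1<_A\cdots<_A t_k$ and $u_1<_A\cdots<_A u_l$; $I(k,l)$ is the set of all shuffles. $a_{k,l}(n)$ is the set of words $v=v_1\cdots v_n$ of length $n$ in these letters. Tableaux are fillings of Young diagrams (English convention), $c(i,j)$ the cell in row $i$, column $j$. $A$-RSK insertion of a letter $x$ into a tableau proceeds in steps, each inserting a letter $y$ into a row or a column: initially $x$ is inserted into row 1 if $x$ is a $t$-letter, into column 1 if it is a $u$-letter. Inserting a $t$-letter $y$ into row $r$: if row $r$ has an entry strictly $A$-greater than $y$, $y$ replaces (bumps) the leftmost such entry; otherwise $y$ is placed in a new cell at the end of row $r$. Inserting a $u$-letter $y$ into column $c$: if column $c$ has an entry strictly $A$-greater than $y$, $y$ bumps the topmost such entry; otherwise $y$ is placed in a new cell at the bottom of column $c$. An entry $z$ bumped from $c(i,j)$ is next inserted into row $i+1$ if $z$ is a $t$-letter, into column $j+1$ if $z$ is a $u$-letter. The insertion ends when a new cell is created. For $v\in a_{k,l}(n)$,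 $P_A$ is obtained by inserting $v_1,\dots,v_n$ successively into the empty tableau, and $Q_A$ is the standard Young tableau of the same shape with entry $m$ in the cell created while inserting $v_m$. $\mathrm{sh}$ denotes shape. *)

theory Defs
  imports Main
begin

datatype letter = T nat | U nat

definition letters :: "nat \<Rightarrow> nat \<Rightarrow> letter set" where
  "letters k l = T ` {1..k} \<union> U ` {1..l}"

text \<open>An order is represented by its strict part: \<open>(x, y) \<in> A\<close> means \<open>x <\<^sub>A y\<close>.\<close>

definition shuffle_orders :: "nat \<Rightarrow> nat \<Rightarrow> (letter \<times> letter) set set" where
  "shuffle_orders k l =
    {A. A \<subseteq> letters k l \<times> letters k l \<and> strict_linear_order_on (letters k l) A \<and>
        (\<forall>i j. 1 \<le> i \<and> i < j \<and> j \<le> k \<longrightarrow> (T i, T j) \<in> A) \<and>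
        (\<forall>i j. 1 \<le> i \<and> i < j \<and> j \<le> l \<longrightarrow> (U i, U j) \<in> A)}"

definition words :: "nat \<Rightarrow> nat \<Rightarrow> nat \<Rightarrow> letter list set" where
  "words k l n = {v. set v \<subseteq> letters k l \<and> length v = n}"

text \<open>
  A filling is a partial map on the cells \<open>(row, column)\<close>, both coordinates counted from 1;
  its shape is the set of its cells, i.e. the Young diagram itself.
\<close>

type_synonym cell = "nat \<times> nat"
type_synonym 'a filling = "cell \<rightharpoonup> 'a"

definition sh :: "'a filling \<Rightarrow> cell set" where
  "sh P = dom P"

text \<open>
  A letter \<open>y\<close> is always inserted into a line of its own kind: a row if \<open>y\<close> is a \<open>t\<close>-letter,
  a column if it is a \<open>u\<close>-letter. So only the number \<open>m\<close> of that line has to be recorded.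
  The \<open>p\<close>-th cell of the line is counted from the left in a row and from the top in a column.
\<close>

fun line_cell :: "letter \<Rightarrow> nat \<Rightarrow> nat \<Rightarrow> cell" where
  "line_cell (T _) m p = (m, p)"
| "line_cell (U _) m p = (p, m)"

fun next_line :: "letter \<Rightarrow> cell \<Rightarrow> nat" where
  "next_line (T _) (i, j) = i + 1"
| "next_line (U _) (i, j) = j + 1"

definition bumpable :: "(letter \<times> letter) set \<Rightarrow> letter filling \<Rightarrow> letter \<Rightarrow> nat \<Rightarrow> nat \<Rightarrow> bool" where
  "bumpable A P y m p \<longleftrightarrow> 1 \<le> p \<and> (\<exists>z. P (line_cell y m p) = Some z \<and> (y, z) \<in> A)"

text \<open>
  The result consists of the new filling and the newly created cell. The recursion terminates
  whenever \<open>A\<close> is a strict order on a finite set, since a bumped letter is strictly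
  \<open>A\<close>-greater than the letter that bumps it.
\<close>

partial_function (tailrec) insert_line ::
  "(letter \<times> letter) set \<Rightarrow> letter filling \<Rightarrow> letter \<Rightarrow> nat \<Rightarrow> letter filling \<times> cell" where
  "insert_line A P y m =
    (if \<exists>p. bumpable A P y m p
     then let c = line_cell y m (LEAST p. bumpable A P y m p);
              z = the (P c)
          in insert_line A (P(c \<mapsto> y)) z (next_line z c)
     else let c = line_cell y m (LEAST p. 1 \<le> p \<and> P (line_cell y m p) = None)
          in (P(c \<mapsto> y), c))"

definition rsk_insert ::
  "(letter \<times> letter) set \<Rightarrow> letter filling \<Rightarrow> letter \<Rightarrow> letter filling \<times> cell" where
  "rsk_insert A P x = insert_line A P x 1"

fun rsk_step ::
  "(letter \<times> letter) set \<Rightarrow> nat \<times> letter \<Rightarrow> letter filling \<times> nat filling \<Rightarrow>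
    letter filling \<times> nat filling" where
  "rsk_step A (m, x) (P, Q) = (let (P', c) = rsk_insert A P x in (P', Q(c \<mapsto> m)))"

definition rsk :: "(letter \<times> letter) set \<Rightarrow> letter list \<Rightarrow> letter filling \<times> nat filling" where
  "rsk A v = fold (rsk_step A) (enumerate 1 v) (Map.empty, Map.empty)"

end

theory Submission
  imports Defs
begin

text \<open>
  Fix a word and an order, and record for every letter \<open>w\<close> the stream of cells which the entries
  \<open>\<le> w\<close> gain in the successive insertions. The stream of a letter is determined by that of its
  predecessor: if the smaller letters gain a cell that is free, it is gained; if that cell is
  occupied (then by \<open>w\<close>), the occupant moves to the end of the next line; and an insertion of \<open>w\<close>
  itself adds a cell at the end of the first line. The recording tableau is thus obtained from the
  empty stream by applying one operator for each letter, in the given order, and the operator of a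
  letter depends only on its kind and its occurrences in the word. (Read as partial
  tableaux of times, the operators are row and column insertion of these occurrences.) Operators of
  a \<open>t\<close>-letter and a \<open>u\<close>-letter commute, so every shuffle gives the same result as applying first
  all \<open>t\<close>-letters and then all \<open>u\<close>-letters. To prove commutation, an operator is split into
  operators with a single occurrence, whose letter always holds at most one cell.
\<close>

section \<open>Diagrams and strips\<close>

declare split_paired_All [simp del] split_paired_Ex [simp del]

definition diagram :: "cell set \<Rightarrow> bool" where
  "diagram D \<longleftrightarrow> finite D \<and> (\<forall>i j. (i, j) \<in> D \<longrightarrow> 1 \<le> i \<and> 1 \<le> j \<and>
     (\<forall>i' j'. 1 \<le> i' \<and> i' \<le> i \<and> 1 \<le> j' \<and> j' \<le> j \<longrightarrow> (i', j') \<in> D))"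

lemma line_cell_inj [simp]: "line_cell d m p = line_cell d m' p' \<longleftrightarrow> m = m' \<and> p = p'"
  by (cases d) auto

lemma next_line_line_cell [simp]: "next_line d (line_cell d m p) = Suc m"
  by (cases d) auto

lemma line_cell_cases: obtains m p where "c = line_cell d m p"
  by (cases d; cases c) auto

text \<open>Being a diagram is invariant under transposition, so it reads the same in row and in
  column coordinates. The letter \<open>d\<close> only selects one of the two, which lets later
  arguments treat both kinds at once.\<close>

lemma diagram_line_cell:
  "diagram D \<longleftrightarrow> finite D \<and> (\<forall>m p. line_cell d m p \<in> D \<longrightarrow> 1 \<le> m \<and> 1 \<le> p \<and>
     (\<forall>m' p'. 1 \<le> m' \<and> m' \<le> m \<and> 1 \<le> p' \<and> p' \<le> p \<longrightarrow> line_cell d m' p' \<in> D))"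
proof (cases d)
  case (U x)
  show ?thesis unfolding U diagram_def line_cell.simps by meson
qed (simp add: diagram_def)

lemma diagram_finite: "diagram D \<Longrightarrow> finite D"
  by (simp add: diagram_def)

lemma diagram_ge1: "diagram D \<Longrightarrow> line_cell d m p \<in> D \<Longrightarrow> 1 \<le> m \<and> 1 \<le> p"
  by (meson diagram_line_cell)

lemma diagram_down:
  "diagram D \<Longrightarrow> line_cell d m p \<in> D \<Longrightarrow> 1 \<le> m' \<Longrightarrow> m' \<le> m \<Longrightarrow> 1 \<le> p' \<Longrightarrow> p' \<le> p \<Longrightarrow>
   line_cell d m' p' \<in> D"
  by (meson diagram_line_cell)

lemma diagram_empty [simp]: "diagram {}"
  by (simp add: diagram_def)

lemma diagram_Un: "diagram D \<Longrightarrow> diagram E \<Longrightarrow> diagram (D \<union> E)"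
  unfolding diagram_def Un_iff finite_Un by meson

lemma diagram_insertI:
  assumes "diagram D" "1 \<le> m" "1 \<le> p"
    and "m = 1 \<or> line_cell d (m - 1) p \<in> D" and "p = 1 \<or> line_cell d m (p - 1) \<in> D"
  shows "diagram (insert (line_cell d m p) D)"
proof -
  have "line_cell d m' p' \<in> insert (line_cell d m p) D"
    if "1 \<le> m'" "m' \<le> m" "1 \<le> p'" "p' \<le> p" for m' p'
  proof (cases "m' = m")
    case True
    then show ?thesis
      using assms that diagram_down[of D d m "p - 1" m' p'] by (cases "p' = p") auto
  next
    case False
    then show ?thesis
      using assms that diagram_down[of D d "m - 1" p m' p'] by auto
  qed
  moreover have "line_cell d m' p' \<in> insert (line_cell d m p) D"
    if "line_cell d m0 p0 \<in> D" "1 \<le> m'" "m' \<le> m0" "1 \<le> p'" "p' \<le> p0" for m0 p0 m' p'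
    using diagram_down[OF assms(1) that] by simp
  moreover have "1 \<le> m0 \<and> 1 \<le> p0" if "line_cell d m0 p0 \<in> insert (line_cell d m p) D" for m0 p0
    using that assms(2,3) diagram_ge1[OF assms(1), of d m0 p0] by auto
  ultimately show ?thesis
    using diagram_finite[OF assms(1)] unfolding diagram_line_cell[of _ d]
    by (metis finite_insert insert_iff line_cell_inj)
qed

section \<open>Ends of lines in a diagram\<close>

definition line_end :: "letter \<Rightarrow> cell set \<Rightarrow> nat \<Rightarrow> cell" where
  "line_end d D m = line_cell d m (LEAST p. 1 \<le> p \<and> line_cell d m p \<notin> D)"

lemma line_end_ex:
  assumes "diagram D"
  shows "\<exists>q. line_end d D m = line_cell d m q \<and> 1 \<le> q \<and> line_cell d m q \<notin> D \<and>
    (\<forall>p. 1 \<le> p \<and> p < q \<longrightarrow> line_cell d m p \<in> D)"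
proof -
  let ?R = "\<lambda>p. 1 \<le> p \<and> line_cell d m p \<notin> D"
  have "finite (line_cell d m -` D)"
    using diagram_finite[OF assms] by (intro finite_vimageI) (auto simp: inj_on_def)
  then obtain b where "\<forall>p \<in> line_cell d m -` D. p \<le> b"
    by (meson finite_nat_set_iff_bounded_le)
  then have "?R (Suc b)" by force
  then have L: "?R (LEAST p. ?R p)" by (rule LeastI)
  moreover have "line_cell d m p \<in> D" if "1 \<le> p" "p < (LEAST p. ?R p)" for p
    using that not_less_Least[of p ?R] by blast
  ultimately show ?thesis
    unfolding line_end_def by blast
qed

lemma line_end_notin: "diagram D \<Longrightarrow> line_end d D m \<notin> D"
  using line_end_ex[of D d m] by auto

lemma line_end_eqI:
  assumes "diagram D" "1 \<le> q" "line_cell d m q \<notin> D" "q = 1 \<or> line_cell d m (q - 1) \<in> D"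
  shows "line_end d D m = line_cell d m q"
proof -
  obtain r where r: "line_end d D m = line_cell d m r" "1 \<le> r" "line_cell d m r \<notin> D"
    "\<And>p. 1 \<le> p \<Longrightarrow> p < r \<Longrightarrow> line_cell d m p \<in> D"
    using line_end_ex[OF assms(1), of d m] by blast
  have "\<not> q < r" using r(4) assms by blast
  moreover have "\<not> r < q"
  proof
    assume "r < q"
    then have "line_cell d m (q - 1) \<in> D" using assms r by auto
    moreover have "1 \<le> m" using calculation diagram_ge1[OF assms(1)] by blast
    ultimately have "line_cell d m r \<in> D"
      using diagram_down[OF assms(1), of d m "q - 1" m r] \<open>r < q\<close> r(2) by simp
    then show False using r by simp
  qed
  ultimately show ?thesis using r by simp
qed

lemma line_end_addable:
  assumes "diagram D" "line_cell d m q \<notin> D" "diagram (insert (line_cell d m q) D)"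
  shows "line_end d D m = line_cell d m q"
proof (rule line_end_eqI[OF assms(1) _ assms(2)])
  have "1 \<le> m" "1 \<le> q" using diagram_ge1[OF assms(3), of d m q] by auto
  moreover have "line_cell d m (q - 1) \<in> D" if "q \<noteq> 1"
  proof -
    have "q - 1 \<noteq> q" "1 \<le> q - 1" using that \<open>1 \<le> q\<close> by auto
    then show ?thesis
      using diagram_down[OF assms(3), of d m q m "q - 1"] \<open>1 \<le> m\<close> by auto
  qed
  ultimately show "1 \<le> q" "q = 1 \<or> line_cell d m (q - 1) \<in> D"
    by auto
qed

lemma line_end_insert:
  assumes "diagram D" "diagram (insert c D)" "c \<noteq> line_end d D m"
  shows "line_end d (insert c D) m = line_end d D m"
proof -
  obtain r where r: "line_end d D m = line_cell d m r" "1 \<le> r" "line_cell d m r \<notin> D"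
    "\<And>p. 1 \<le> p \<Longrightarrow> p < r \<Longrightarrow> line_cell d m p \<in> D"
    using line_end_ex[OF assms(1), of d m] by blast
  have "line_end d (insert c D) m = line_cell d m r"
  proof (rule line_end_eqI[OF assms(2) r(2)])
    show "r = 1 \<or> line_cell d m (r - 1) \<in> insert c D"
      using r(2) r(4)[of "r - 1"] by (cases "r = 1") auto
  qed (use r assms(3) in auto)
  then show ?thesis using r by simp
qed

section \<open>Horizontal and vertical strips\<close>

text \<open>A horizontal strip if \<open>d\<close> is a \<open>t\<close>-letter, a vertical strip if \<open>d\<close> is a \<open>u\<close>-letter.\<close>

definition strip :: "letter \<Rightarrow> cell set \<Rightarrow> cell set \<Rightarrow> bool" where
  "strip d M N \<longleftrightarrow> diagram M \<and> diagram N \<and> M \<subseteq> N \<and>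
     (\<forall>m m' p. line_cell d m p \<in> N - M \<and> line_cell d m' p \<in> N - M \<longrightarrow> m = m')"

lemma stripD:
  assumes "strip d M N"
  shows "diagram M" "diagram N" "M \<subseteq> N"
    "line_cell d m p \<in> N \<Longrightarrow> line_cell d m p \<notin> M \<Longrightarrow> line_cell d m' p \<in> N \<Longrightarrow>
     line_cell d m' p \<notin> M \<Longrightarrow> m = m'"
  using assms unfolding strip_def by blast+

lemma strip_insert_lower:
  "strip d M N \<Longrightarrow> c \<in> N \<Longrightarrow> diagram (insert c M) \<Longrightarrow> strip d (insert c M) N"
  unfolding strip_def by blast

lemma strip_insert_both:
  assumes "strip d M N" "diagram (insert c M)"
  shows "strip d (insert c M) (insert c N)"
proof -
  have "insert c N = insert c M \<union> N" using stripD(3)[OF assms(1)] by blast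
  then have "diagram (insert c N)" using diagram_Un[OF assms(2) stripD(2)[OF assms(1)]] by simp
  then show ?thesis using assms unfolding strip_def by blast
qed

text \<open>A clash could only come from another cell of \<open>N - M\<close> at place
  \<open>q\<close>. In earlier lines the cells at that place lie in \<open>M\<close> because of
  \<open>up\<close>; one in a later line would force the new cell into the diagram
  \<open>N\<close>.\<close>

lemma strip_insert_upper:
  assumes st: "strip d M N" and "1 \<le> m" and le: "line_end d N m = line_cell d m q"
    and up: "m = 1 \<or> line_cell d (m - 1) q \<in> M"
  shows "strip d M (insert (line_cell d m q) N)"
proof -
  note D = stripD[OF st]
  have q': "1 \<le> q" "line_cell d m q \<notin> N" "\<And>p. 1 \<le> p \<Longrightarrow> p < q \<Longrightarrow> line_cell d m p \<in> N"
    using line_end_ex[OF D(2), of d m] le by auto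
  have "q = 1 \<or> line_cell d m (q - 1) \<in> N"
    using q'(1) q'(3)[of "q - 1"] by (cases "q = 1") auto
  have diag: "diagram (insert (line_cell d m q) N)"
    by (rule diagram_insertI[OF D(2) \<open>1 \<le> m\<close> q'(1)]) (use up D(3) \<open>q = 1 \<or> _\<close> in auto)
  have "m' = m" if "line_cell d m' q \<in> N" "line_cell d m' q \<notin> M" for m'
  proof (rule ccontr)
    assume "m' \<noteq> m"
    have "1 \<le> m'" using diagram_ge1[OF D(2) that(1)] by simp
    show False
    proof (cases "m' < m")
      case True
      then have "m \<noteq> 1" "m' \<le> m - 1" using \<open>1 \<le> m'\<close> by auto
      then show False
        using up diagram_down[OF D(1), of d "m - 1" q m' q] \<open>1 \<le> m'\<close> q'(1) that by blast
    next
      case False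
      then show False
        using diagram_down[OF D(2) that(1), of m q] \<open>1 \<le> m\<close> q' \<open>m' \<noteq> m\<close> by auto
    qed
  qed
  then show ?thesis
    using st diag unfolding strip_def by (auto 0 3)
qed

text \<open>The cell at place \<open>p\<close> of the next line is free, since a strip has only one
  cell per place; hence that line ends at or before \<open>p\<close>. A displaced letter thus moves
  weakly towards the start of its lines.\<close>

lemma strip_bump_place:
  assumes st: "strip d M N" and c: "line_cell d m p \<in> N" "line_cell d m p \<notin> M"
    and le: "line_end d N (Suc m) = line_cell d (Suc m) q"
  shows "q \<le> p"
proof -
  note D = stripD[OF st]
  have m: "1 \<le> m" "1 \<le> p" using diagram_ge1[OF D(2) c(1)] by auto
  have "line_cell d (Suc m) p \<notin> N"
  proof
    assume "line_cell d (Suc m) p \<in> N"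
    moreover have "line_cell d (Suc m) p \<notin> M"
      using diagram_down[OF D(1), of d "Suc m" p m p] m c by auto
    ultimately have "Suc m = m" using D(4)[of "Suc m" p m] c by blast
    then show False by simp
  qed
  moreover have "\<And>p. 1 \<le> p \<Longrightarrow> p < q \<Longrightarrow> line_cell d (Suc m) p \<in> N"
    using line_end_ex[OF D(2), of d "Suc m"] le by auto
  ultimately show ?thesis using m by force
qed

text \<open>The displaced letter lands weakly before the place of \<open>c\<close>, so the cell of
  the old line at the landing place lies in \<open>insert c M\<close>; this is what
  \<open>strip_insert_upper\<close> asks for.\<close>

lemma strip_bump:
  assumes st: "strip d M N" and c: "c \<in> N" "c \<notin> M" and diag: "diagram (insert c M)"
  shows "strip d (insert c M) (insert (line_end d N (next_line d c)) N)"
proof -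
  obtain m p where mp: "c = line_cell d m p" by (rule line_cell_cases)
  obtain q where q: "line_end d N (Suc m) = line_cell d (Suc m) q" "1 \<le> q"
    using line_end_ex[OF stripD(2)[OF st], of d "Suc m"] by blast
  have "q \<le> p" using strip_bump_place[OF st] c q mp by blast
  moreover have "1 \<le> m" using diagram_ge1[OF diag, of d m p] mp by simp
  ultimately have "line_cell d m q \<in> insert c M"
    using diagram_down[OF diag, of d m p m q] mp q by auto
  then show ?thesis
    using strip_insert_upper[OF strip_insert_lower[OF st c(1) diag], of "Suc m" q] q mp by simp
qed

lemma strip_trigger:
  assumes st: "strip d M N"
  shows "strip d M (insert (line_end d N 1) N)"
  using line_end_ex[OF stripD(2)[OF st], of d 1] strip_insert_upper[OF st, of 1] by auto

section \<open>Streams of new cells\<close>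

text \<open>Times start at 0: \<open>e t\<close> is the cell gained during step \<open>t\<close>, so
  \<open>cells e t\<close> is the state before that step.\<close>

definition cells :: "(nat \<Rightarrow> cell option) \<Rightarrow> nat \<Rightarrow> cell set" where
  "cells e t = {c. \<exists>s<t. e s = Some c}"

lemma cells_0 [simp]: "cells e 0 = {}"
  by (simp add: cells_def)

lemma cells_Suc: "cells e (Suc t) = set_option (e t) \<union> cells e t"
  by (auto simp: cells_def less_Suc_eq)

text \<open>Equivalently, a growing chain of Young diagrams, or a standard filling by those times at
  which a cell arrives.\<close>

definition valid :: "(nat \<Rightarrow> cell option) \<Rightarrow> bool" where
  "valid e \<longleftrightarrow> (\<forall>t. diagram (cells e t) \<and> (\<forall>c. e t = Some c \<longrightarrow> c \<notin> cells e t))"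

text \<open>Here \<open>x\<close> is the cell gained by the smaller letters and \<open>N\<close> the
  diagram of the entries up to the letter itself. A gained cell that lies in \<open>N\<close> was
  held by the letter, which is displaced; \<open>b\<close> marks an occurrence of the
  letter.\<close>

definition emit :: "letter \<Rightarrow> bool \<Rightarrow> cell set \<Rightarrow> cell option \<Rightarrow> cell option" where
  "emit d b N x = (case x of
     None \<Rightarrow> if b then Some (line_end d N 1) else None
   | Some c \<Rightarrow> Some (if c \<in> N then line_end d N (next_line d c) else c))"

text \<open>A stream produced by \<open>emit\<close> depends on its own past. The recursion builds
  its diagram first, and \<open>cells_run\<close> confirms that this is the diagram of the stream
  \<open>run\<close>.\<close>

primrec occupied :: "letter \<Rightarrow> nat set \<Rightarrow> (nat \<Rightarrow> cell option) \<Rightarrow> nat \<Rightarrow> cell set" where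
  "occupied d S e 0 = {}"
| "occupied d S e (Suc t) = set_option (emit d (t \<in> S) (occupied d S e t) (e t)) \<union> occupied d S e t"

definition run :: "letter \<Rightarrow> nat set \<Rightarrow> (nat \<Rightarrow> cell option) \<Rightarrow> nat \<Rightarrow> cell option" where
  "run d S e t = emit d (t \<in> S) (occupied d S e t) (e t)"

lemma cells_run: "cells (run d S e) t = occupied d S e t"
  by (induction t) (auto simp: cells_Suc run_def)

lemma run_eq: "run d S e t = emit d (t \<in> S) (cells (run d S e) t) (e t)"
  by (simp add: cells_run run_def)

lemma dom_run: "dom (run d S e) = dom e \<union> S"
  by (auto simp: run_def emit_def split: option.splits if_splits)

lemma emit_notin: "diagram N \<Longrightarrow> emit d b N x = Some c \<Longrightarrow> c \<notin> N"
  by (auto simp: emit_def line_end_notin split: option.splits if_splits)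

lemma strip_emit:
  assumes "strip d M N" "diagram (set_option x \<union> M)" "\<And>c. x = Some c \<Longrightarrow> c \<notin> M"
  shows "strip d (set_option x \<union> M) (set_option (emit d b N x) \<union> N)"
  using assms strip_insert_both[of d M N] strip_bump[of d M N] strip_trigger[of d M N]
  by (auto simp: emit_def split: option.splits)

text \<open>The difference of the two diagrams consists of the cells held by the letter. Passing,
  displacement and a new occurrence each keep it a strip.\<close>

lemma strip_run:
  assumes "valid e"
  shows "strip d (cells e t) (cells (run d S e) t)"
proof (induction t)
  case 0
  then show ?case by (simp add: strip_def)
next
  case (Suc t)
  show ?case
    unfolding cells_Suc run_eq[of d S e t]
    by (rule strip_emit[OF Suc]) (use assms in \<open>auto simp: valid_def simp flip: cells_Suc\<close>)
qed

lemma valid_run: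
  assumes "valid e"
  shows "valid (run d S e)"
  unfolding valid_def
  using stripD(2)[OF strip_run[OF assms]] emit_notin run_eq by metis

section \<open>Splitting off the last occurrence of a letter\<close>

definition place :: "letter \<Rightarrow> cell \<Rightarrow> nat" where
  "place d c = (case d of T _ \<Rightarrow> snd c | U _ \<Rightarrow> fst c)"

lemma place_line_cell [simp]: "place d (line_cell d m p) = p"
  by (cases d) (auto simp: place_def)

text \<open>The first line is the longest: it has a cell at every place used in \<open>K\<close>, so
  its end lies beyond all of them.\<close>

lemma place_first_line_end:
  assumes "diagram K" "c \<in> K"
  shows "place d c < place d (line_end d K 1)"
proof -
  obtain m j where c: "c = line_cell d m j" by (rule line_cell_cases)
  obtain q where q: "line_end d K 1 = line_cell d 1 q" "1 \<le> q" "line_cell d 1 q \<notin> K"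
    using line_end_ex[OF assms(1), of d 1] by blast
  have "1 \<le> m" using diagram_ge1[OF assms(1), of d m j] c assms(2) by simp
  then have "\<not> q \<le> j"
    using diagram_down[OF assms(1), of d m j 1 q] q c assms(2) by auto
  then show ?thesis using q c by simp
qed

text \<open>A cell \<open>q\<close> of \<open>K - M\<close> in the line of \<open>p\<close> or an
  earlier one would lie in the diagram \<open>insert p M\<close>. So \<open>q\<close> lies in a
  later line, and the line after that of \<open>p\<close> is filled at least up to the place of
  \<open>q\<close>.\<close>

lemma bump_single:
  assumes st: "strip d M K" and K': "diagram (insert p K)" "p \<notin> K"
    and right: "\<forall>q \<in> K - M. place d q < place d p"
    and diag: "diagram (insert p M)"
    and q: "q \<in> K - M"
  shows "place d q < place d (line_end d (insert p K) (next_line d p))"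
proof -
  note D = stripD[OF st]
  obtain r k where p: "p = line_cell d r k" by (rule line_cell_cases)
  obtain m j where mj: "q = line_cell d m j" by (rule line_cell_cases)
  obtain l where l: "line_end d (insert p K) (Suc r) = line_cell d (Suc r) l" "1 \<le> l"
      "line_cell d (Suc r) l \<notin> insert p K"
    using line_end_ex[OF K'(1), of d "Suc r"] by blast
  have "j < k" using bspec[OF right q] p mj by simp
  have ge: "1 \<le> m" "1 \<le> j" using diagram_ge1[OF D(2), of d m j] q mj by auto
  have "\<not> m \<le> r"
  proof
    assume "m \<le> r"
    then have "q \<in> insert p M"
      using diagram_down[OF diag, of d r k m j] ge \<open>j < k\<close> p mj by auto
    then show False using q K' by auto
  qed
  then have "\<not> l \<le> j"
    using diagram_down[OF D(2), of d m j "Suc r" l] l q mj by auto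
  then show ?thesis using mj l p by simp
qed

text \<open>
  The cell \<open>p\<close> of the last occurrence of a letter stays strictly beyond the cells of its other
  occurrences, so a bumped occurrence never reaches \<open>p\<close>.
\<close>

lemma merge_step:
  assumes st: "strip d M K" and st': "strip d K (insert p K)" and p: "p \<notin> K"
    and right: "\<forall>q \<in> K - M. place d q < place d p"
    and x: "\<And>c. x = Some c \<Longrightarrow> c \<notin> M \<and> diagram (insert c M)"
    and y: "y = emit d False K x" and z: "z = emit d False (insert p K) y"
  shows "z = emit d False (insert p K) x \<and>
    (\<exists>p'. set_option z \<union> insert p K = insert p' (set_option y \<union> K) \<and> p' \<notin> set_option y \<union> K \<and>
      (\<forall>q \<in> (set_option y \<union> K) - (set_option x \<union> M). place d q < place d p'))"
proof (cases x)
  case None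
  then show ?thesis using y z p right by (auto simp: emit_def)
next
  case (Some c)
  note D = stripD[OF st] and D' = stripD[OF st']
  have c: "c \<notin> M" "diagram (insert c M)" using x Some by auto
  obtain r k where rk: "c = line_cell d r k" by (rule line_cell_cases)
  show ?thesis
  proof (cases "c \<in> K")
    case True
    define c' where "c' = line_end d K (next_line d c)"
    obtain l where l: "c' = line_cell d (Suc r) l"
      using line_end_ex[OF D(2), of d "Suc r"] rk c'_def by auto
    have "l \<le> k"
      using strip_bump_place[OF st] True c(1) rk l c'_def by simp
    moreover have "k < place d p" using bspec[OF right, of c] True c(1) rk by simp
    ultimately have "place d c' < place d p" using l by simp
    then have ne: "c' \<noteq> p" by auto
    have "c' \<notin> K" using line_end_notin[OF D(2)] c'_def by simp
    have "p \<noteq> line_end d K (next_line d c)" using ne c'_def by auto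
    then have same: "line_end d (insert p K) (next_line d c) = c'"
      using line_end_insert[OF D(2) D'(2)] c'_def by simp
    have "y = Some c'" using y Some True by (simp add: emit_def c'_def)
    then have "z = Some c'" using z ne \<open>c' \<notin> K\<close> by (simp add: emit_def)
    moreover have "emit d False (insert p K) x = Some c'"
      using Some True same by (simp add: emit_def)
    ultimately show ?thesis
      using \<open>y = Some c'\<close> ne p right \<open>place d c' < place d p\<close> Some by auto
  next
    case False
    then have y: "y = Some c" using y Some by (simp add: emit_def)
    show ?thesis
    proof (cases "c = p")
      case True
      define p' where "p' = line_end d (insert p K) (next_line d p)"
      have "p' \<notin> insert p K" using line_end_notin[OF D'(2)] p'_def by simp
      moreover have "\<forall>q \<in> K - M. place d q < place d p'"
        using bump_single[OF st D'(2) p right] c True p'_def by simp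
      moreover have "z = Some p'" using z y True by (simp add: emit_def p'_def)
      ultimately show ?thesis using Some y z True by auto
    next
      case ne: False
      then have "z = Some c" using z y False by (simp add: emit_def)
      then show ?thesis using Some y z ne p right by auto
    qed
  qed
qed

lemma valid_cellsD:
  assumes "valid e" "e t = Some c"
  shows "c \<notin> cells e t \<and> diagram (insert c (cells e t))"
proof -
  have "diagram (cells e (Suc t))" using assms(1) unfolding valid_def by blast
  then show ?thesis using assms by (simp add: valid_def cells_Suc)
qed

text \<open>This is standardization: the latest of several equal letters may be regarded as a
  separate larger letter. Before time \<open>s\<close> the extra operator lets everything pass; at
  \<open>s\<close> the occurrence goes to the end of the first line; afterwards
  \<open>merge_step\<close> applies.\<close>

lemma run_insert_max:
  assumes e: "valid e" and S: "\<forall>x \<in> S. x < s" and s: "e s = None"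
  shows "run d (insert s S) e = run d {s} (run d S e)"
proof -
  let ?K = "run d S e" and ?N = "run d {s} (run d S e)" and ?N' = "run d (insert s S) e"
  have vK: "valid ?K" using valid_run[OF e] .
  have early: "?N t = ?K t \<and> ?N' t = ?K t"
    if "t < s" "cells ?N t = cells ?K t" "cells ?N' t = cells ?K t" for t
  proof
    have "?N t = emit d False (cells ?K t) (?K t)"
      using run_eq[of d "{s}" "?K" t] that by simp
    also have "\<dots> = ?K t"
      using valid_cellsD[OF vK, of t] by (cases "?K t") (simp_all add: emit_def)
    finally show "?N t = ?K t" .
    show "?N' t = ?K t"
      using run_eq[of d "insert s S" e t] run_eq[of d S e t] that by simp
  qed
  \<comment> \<open>After step \<open>s\<close>, \<open>p\<close> is the single cell held by the
    split-off occurrence, strictly beyond the cells of all others.\<close>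
  have I: "cells ?N t = cells ?N' t \<and>
    (if t \<le> s then cells ?N t = cells ?K t
     else \<exists>p. p \<notin> cells ?K t \<and> cells ?N t = insert p (cells ?K t) \<and>
       (\<forall>q \<in> cells ?K t - cells e t. place d q < place d p)) \<and> (\<forall>u < t. ?N u = ?N' u)" for t
  proof (induction t)
    case 0
    then show ?case by simp
  next
    case (Suc t)
    consider "t < s" | "t = s" | "s < t" by linarith
    then show ?case
    proof cases
      case 1
      then have eqs: "cells ?N t = cells ?K t" "cells ?N' t = cells ?K t" using Suc by auto
      show ?thesis using 1 Suc early[OF 1 eqs] eqs by (auto simp: cells_Suc less_Suc_eq)
    next
      case 2
      have "s \<notin> S" using S by blast
      then have K: "?K t = None" using s 2 by (simp add: run_def emit_def)
      have eqs: "cells ?N t = cells ?K t" "cells ?N' t = cells ?K t"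
        using Suc 2 by auto
      define p where "p = line_end d (cells ?K t) 1"
      have N: "?N t = Some p"
        unfolding run_eq[of d "{s}" "?K" t] eqs using K 2 by (simp add: emit_def p_def)
      have N': "?N' t = Some p"
        unfolding run_eq[of d "insert s S" e t] eqs using s 2 by (simp add: emit_def p_def)
      have dK: "diagram (cells ?K t)" using vK by (simp add: valid_def)
      have "cells ?K (Suc t) = cells ?K t" using K by (simp add: cells_Suc)
      moreover have "cells ?N (Suc t) = insert p (cells ?K t)" "cells ?N' (Suc t) = insert p (cells ?K t)"
        using N N' eqs by (simp_all add: cells_Suc)
      moreover have "p \<notin> cells ?K t" "\<forall>q \<in> cells ?K t - cells e (Suc t). place d q < place d p"
        using line_end_notin[OF dK] place_first_line_end[OF dK] by (simp_all add: p_def)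
      moreover have "\<forall>u < Suc t. ?N u = ?N' u"
        using Suc N N' by (simp add: less_Suc_eq)
      ultimately show ?thesis using 2 by auto
    next
      case 3
      then obtain p where p: "p \<notin> cells ?K t" "cells ?N t = insert p (cells ?K t)"
        "\<forall>q \<in> cells ?K t - cells e t. place d q < place d p"
        using Suc 3 by (auto simp del: split_paired_Ex)
      have "t \<notin> S" "t \<notin> insert s S" using S 3 by auto
      then have K: "?K t = emit d False (cells ?K t) (e t)"
        using run_eq[of d S e t] by simp
      have N: "?N t = emit d False (insert p (cells ?K t)) (?K t)"
        using run_eq[of d "{s}" "?K" t] p 3 by auto
      have N': "?N' t = emit d False (insert p (cells ?K t)) (e t)"
        using run_eq[of d "insert s S" e t] \<open>t \<notin> insert s S\<close> p(2) Suc by simp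
      have "strip d (cells ?K t) (insert p (cells ?K t))"
        using strip_run[OF vK, of d t "{s}"] p by simp
      from merge_step[OF strip_run[OF e] this p(1,3) valid_cellsD[OF e] K N]
      obtain p' where "?N t = ?N' t" "set_option (?N t) \<union> cells ?N t = insert p' (cells ?K (Suc t))"
        "p' \<notin> cells ?K (Suc t)"
        "\<forall>q \<in> cells ?K (Suc t) - cells e (Suc t). place d q < place d p'"
        unfolding cells_Suc N' p(2) by metis
      moreover have "cells ?N' t = cells ?N t" "\<forall>u < t. ?N u = ?N' u" using Suc by auto
      ultimately show ?thesis
        using 3 by (auto simp: cells_Suc less_Suc_eq)
    qed
  qed
  show ?thesis
    using I by (intro ext) (metis lessI)
qed

lemma run_empty:
  assumes "valid e"
  shows "run d {} e = e"
proof -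
  have "cells (run d {} e) t = cells e t \<and> (\<forall>u < t. run d {} e u = e u)" for t
  proof (induction t)
    case (Suc t)
    then have "run d {} e t = e t"
      using run_eq[of d "{}" e t] valid_cellsD[OF assms, of t]
      by (auto simp: emit_def split: option.splits)
    then show ?case using Suc by (auto simp: cells_Suc less_Suc_eq)
  qed auto
  then show ?thesis by (intro ext) (metis lessI)
qed

section \<open>Commutation of operators of opposite kinds\<close>

definition opposite :: "letter \<Rightarrow> letter \<Rightarrow> bool" where
  "opposite d d' \<longleftrightarrow> (\<forall>m p. line_cell d' m p = line_cell d p m)"

lemma opposite_sym: "opposite d d' \<Longrightarrow> opposite d' d"
  by (simp add: opposite_def)

section \<open>One time step of two operators with a single occurrence each\<close>

text \<open>
  The invariant behind commutation. \<open>M\<close> is the diagram of the input, \<open>N1\<close> and \<open>N2\<close> are the diagrams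
  after one of the two operators, \<open>N\<close> is the diagram after both. Either each letter holds the same
  cell in both orders of application, or the two cells \<open>p\<close> and \<open>q\<close> are comparable; in that case
  the operator applied first always holds the inner cell \<open>p\<close>, so the letters swap their cells.
\<close>

definition linked :: "cell set \<Rightarrow> cell set \<Rightarrow> cell set \<Rightarrow> cell set \<Rightarrow> bool \<Rightarrow> bool \<Rightarrow> bool" where
  "linked M N1 N2 N b1 b2 \<longleftrightarrow>
     (\<exists>x y. (x \<noteq> None) = b1 \<and> (y \<noteq> None) = b2 \<and>
        N1 = set_option x \<union> M \<and> N2 = set_option y \<union> M \<and> N = set_option x \<union> set_option y \<union> M \<and>
        set_option x \<inter> M = {} \<and> set_option y \<inter> M = {} \<and> set_option x \<inter> set_option y = {}) \<or>
     (b1 \<and> b2 \<and> (\<exists>p q. N1 = insert p M \<and> N2 = insert p M \<and> N = insert q (insert p M) \<and>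
        p \<notin> M \<and> q \<notin> insert p M \<and> fst p \<le> fst q \<and> snd p \<le> snd q))"

lemma linked_sym: "linked M N1 N2 N b1 b2 \<Longrightarrow> linked M N2 N1 N b2 b1"
  unfolding linked_def by (elim disjE) (blast, blast)

text \<open>The letter \<open>d\<close> enters line \<open>m\<close> while the other letter holds
  \<open>y\<close>. If \<open>y\<close> is not the end \<open>c\<close>, they do not meet. If it is,
  then in one order \<open>d'\<close> is displaced from \<open>c\<close>, in the other
  \<open>d\<close> goes beyond \<open>c\<close>; \<open>side\<close> makes both reach the cell after
  \<open>c\<close> in line \<open>m\<close>, and the state becomes nested.\<close>

lemma move:
  assumes opp: "opposite d d'" and K: "diagram K" and YK: "diagram (set_option y \<union> K)"
    and disj: "set_option y \<inter> K = {}" and m: "1 \<le> m"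
    and c: "c = line_end d K m"
    and side: "\<And>j. y = Some c \<Longrightarrow> c = line_cell d m j \<Longrightarrow> m = 1 \<or> line_cell d (m - 1) (Suc j) \<in> K"
    and r: "r = line_end d (set_option y \<union> K) m"
  shows "emit d' False (set_option y \<union> K) (Some c) = Some r \<and>
    linked K (insert c K) (set_option y \<union> K) (insert r (set_option y \<union> K)) True (y \<noteq> None)"
proof (cases "y = Some c")
  case False
  have "c \<notin> K" using line_end_notin[OF K] c by simp
  have "r = c"
    using False line_end_insert[OF K, of _ d m] YK r c by (cases y) auto
  then show ?thesis
    using False \<open>c \<notin> K\<close> disj unfolding linked_def
    by (intro conjI disjI1 exI[of _ "Some c"] exI[of _ y]) (auto simp: emit_def)
next
  case True
  obtain j where j: "c = line_cell d m j" "1 \<le> j"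
    using line_end_ex[OF K, of d m] c by auto
  have cK: "c \<notin> K" using line_end_notin[OF K] c by simp
  have iK: "diagram (insert c K)" using YK True by simp
  have notin: "line_cell d m (Suc j) \<notin> insert c K"
  proof
    assume "line_cell d m (Suc j) \<in> insert c K"
    then have "line_cell d m (Suc j) \<in> K" using j by simp
    then show False using diagram_down[OF K, of d m "Suc j" m j] j cK m by simp
  qed
  have "r = line_end d (insert c K) m" using r True by simp
  also have "\<dots> = line_cell d m (Suc j)"
    by (rule line_end_eqI[OF iK _ notin]) (use j in auto)
  finally have rj: "r = line_cell d m (Suc j)" .
  have "c = line_cell d' j m" using j opp by (simp add: opposite_def)
  then have nl: "next_line d' c = Suc j" by simp
  have up: "m = 1 \<or> line_cell d (m - 1) (Suc j) \<in> insert c K"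
    using side[OF True j(1)] by auto
  \<comment> \<open>In the next line of \<open>d'\<close> the place before \<open>m\<close> is
    filled by \<open>up\<close>, so that line ends in the same cell \<open>r\<close>.\<close>
  have "line_end d' (insert c K) (Suc j) = line_cell d' (Suc j) m"
    by (rule line_end_eqI[OF iK m]) (use notin up opp in \<open>auto simp: opposite_def\<close>)
  then have "line_end d' (insert c K) (next_line d' c) = r"
    using nl rj opp by (simp add: opposite_def)
  moreover have "fst c \<le> fst r \<and> snd c \<le> snd r"
    using j rj by (cases d) auto
  ultimately show ?thesis
    using True cK notin rj unfolding linked_def
    by (intro conjI disjI2 exI[of _ c] exI[of _ r]) (auto simp: emit_def)
qed

lemma trigger_step:
  assumes opp: "opposite d d'" and M: "diagram M" and N: "diagram N"
    and link: "linked M N1 N2 N False b"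
  shows "emit d' False N (emit d True N1 None) = emit d True N (emit d' False N2 None) \<and>
    linked M (set_option (emit d True N1 None) \<union> N1) (set_option (emit d' False N2 None) \<union> N2)
      (set_option (emit d True N (emit d' False N2 None)) \<union> N) True b"
proof -
  obtain x y where "(x \<noteq> None) = False" and y: "(y \<noteq> None) = b" "N1 = set_option x \<union> M"
    "N2 = set_option y \<union> M" "N = set_option x \<union> set_option y \<union> M" "set_option y \<inter> M = {}"
    using link unfolding linked_def by blast
  then have y: "(y \<noteq> None) = b" "N1 = M" "N2 = set_option y \<union> M" "N = set_option y \<union> M"
    "set_option y \<inter> M = {}" by auto
  have "diagram (set_option y \<union> M)" using N y by simp
  from move[OF opp M this y(5) le_refl refl _ refl] show ?thesis
    using y by (simp add: emit_def)
qed

text \<open>The input takes the cell \<open>c\<close> held by \<open>d\<close>, which then enters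
  its next line, so \<open>move\<close> applies over \<open>insert c M\<close>. The condition
  \<open>side\<close> holds because a cell of the other letter in that line lies strictly before the
  place of \<open>c\<close>.\<close>

lemma bump_step:
  assumes opp: "opposite d d'" and N2: "diagram N2" and N: "diagram N" and K: "diagram (insert c M)"
    and c: "c \<notin> M" and y: "set_option y \<inter> insert c M = {}"
    and N1: "N1 = insert c M" and N2_eq: "N2 = set_option y \<union> M" and N_eq: "N = insert c N2"
  shows "emit d' False N (emit d False N1 (Some c)) = emit d False N (emit d' False N2 (Some c)) \<and>
    linked (insert c M) (set_option (emit d False N1 (Some c)) \<union> N1)
      (set_option (emit d' False N2 (Some c)) \<union> N2)
      (set_option (emit d False N (emit d' False N2 (Some c))) \<union> N) True (y \<noteq> None)"
proof -
  obtain r k where rk: "c = line_cell d r k" by (rule line_cell_cases)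
  have ge: "1 \<le> r" "1 \<le> k" using diagram_ge1[OF K, of d r k] rk by auto
  have N': "N = set_option y \<union> insert c M" using N_eq N2_eq by auto
  have side: "line_cell d r (Suc j) \<in> insert c M"
    if "y = Some q" "q = line_cell d (Suc r) j" for q j
  proof -
    have "q \<in> N2" using that N2_eq by simp
    then have j: "1 \<le> j" using diagram_ge1[OF N2, of d "Suc r" j] that by simp
    have "line_cell d r j \<in> N2"
      using diagram_down[OF N2, of d "Suc r" j r j] \<open>q \<in> N2\<close> that ge j by simp
    then have "line_cell d r j \<in> M" using that N2_eq by auto
    have "\<not> k \<le> j"
    proof
      assume "k \<le> j"
      then have "c \<in> N2"
        using diagram_down[OF N2 \<open>line_cell d r j \<in> N2\<close>, of r k] ge rk by simp
      then show False using c y N2_eq by auto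
    qed
    then show ?thesis using diagram_down[OF K, of d r k r "Suc j"] rk ge by simp
  qed
  have dN: "diagram (set_option y \<union> insert c M)" using N N' by simp
  have nl: "next_line d c = Suc r" using rk by simp
  have y2: "emit d' False N2 (Some c) = Some c" using c y N2_eq by (auto simp: emit_def)
  have "emit d False N1 (Some c) = Some (line_end d (insert c M) (Suc r))"
    using N1 nl by (simp add: emit_def)
  moreover have "emit d False N (Some c) = Some (line_end d (set_option y \<union> insert c M) (Suc r))"
    using N' nl by (simp add: emit_def)
  moreover have "insert c N2 = set_option y \<union> insert c M" using N2_eq by auto
  ultimately show ?thesis
    using move[OF opp K dN y _ refl _ refl, of "Suc r"] side y2 N' N1
    by (simp add: insert_commute)
qed

text \<open>The input takes the inner cell \<open>p\<close> of a nested pair. The letter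
  \<open>d\<close>, whose next line contains \<open>q\<close>, ends up with \<open>q\<close> in both
  orders, and the other letter with the end \<open>c\<close> of its own next line: the nested state
  dissolves.\<close>

lemma hook_step:
  assumes opp: "opposite d d'" and K: "diagram K" and N: "diagram (insert q K)" and q: "q \<notin> K"
    and p: "p \<in> K" "p = line_cell d r j" and qj: "q = line_cell d (Suc r) j"
  shows "emit d' False (insert q K) (emit d False K (Some p)) =
      emit d False (insert q K) (emit d' False K (Some p)) \<and>
    linked K (set_option (emit d False K (Some p)) \<union> K) (set_option (emit d' False K (Some p)) \<union> K)
      (set_option (emit d False (insert q K) (emit d' False K (Some p))) \<union> insert q K) True True"
proof -
  define c where "c = line_end d' K (Suc j)"
  have nl: "next_line d p = Suc r" "next_line d' p = Suc j" "next_line d' q = Suc j"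
    using p qj opp next_line_line_cell unfolding opposite_def by metis+
  have e1: "emit d False K (Some p) = Some q"
    using p nl line_end_addable[OF K] N q qj by (simp add: emit_def)
  have e2: "emit d' False K (Some p) = Some c"
    using p nl by (simp add: emit_def c_def)
  have "c \<notin> K" using line_end_notin[OF K] c_def by simp
  have "q = line_cell d' j (Suc r)" using qj opp by (simp add: opposite_def)
  then have "q \<noteq> c" using line_end_ex[OF K, of d' "Suc j"] c_def by auto
  then have "line_end d' (insert q K) (Suc j) = c"
    using line_end_insert[OF K N] c_def by simp
  then have "emit d' False (insert q K) (Some q) = Some c"
    using nl by (simp add: emit_def)
  moreover have e3: "emit d False (insert q K) (Some c) = Some c"
    using \<open>c \<notin> K\<close> \<open>q \<noteq> c\<close> by (simp add: emit_def)
  moreover have "linked K (insert q K) (insert c K) (insert c (insert q K)) True True"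
    unfolding linked_def
    by (intro disjI1 exI[of _ "Some q"] exI[of _ "Some c"]) (use q \<open>c \<notin> K\<close> \<open>q \<noteq> c\<close> in auto)
  ultimately show ?thesis using e1 e2 by (simp add: insert_commute)
qed

text \<open>The only cell of \<open>insert p M\<close> weakly beyond \<open>p\<close> is
  \<open>p\<close>, since \<open>M\<close> is a diagram without \<open>p\<close>. A cell preceding
  \<open>q\<close> and still weakly beyond \<open>p\<close> must therefore be
  \<open>p\<close>.\<close>

lemma adjacent_cells:
  assumes M: "diagram (insert p M)" and N: "diagram (insert q (insert p M))"
    and p: "p \<notin> M" and q: "q \<notin> insert p M" and le: "fst p \<le> fst q" "snd p \<le> snd q"
    and M0: "diagram M"
  shows "q = (Suc (fst p), snd p) \<or> q = (fst p, Suc (snd p))"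
proof -
  obtain i j i' j' where ij: "p = (i, j)" "q = (i', j')" by (cases p; cases q)
  have down: "(i0, j0) \<in> D" if "diagram D" "(i1, j1) \<in> D" "1 \<le> i0" "i0 \<le> i1" "1 \<le> j0" "j0 \<le> j1"
    for D i0 j0 i1 j1
    using diagram_down[of D "T 0" i1 j1 i0 j0] that by simp
  have ge: "1 \<le> i" "1 \<le> j" using diagram_ge1[OF M, of "T 0" i j] ij by auto
  have above: "x = p" if "x \<in> insert p M" "i \<le> fst x" "j \<le> snd x" for x
    using that down[OF M0, of "fst x" "snd x" i j] ge p ij by auto
  have "(i' - 1, j') = p" if "i < i'"
  proof (rule above)
    have "(i' - 1, j') \<in> insert q (insert p M)"
      using down[OF N, of i' j' "i' - 1" j'] that ij le ge by auto
    then show "(i' - 1, j') \<in> insert p M" using that ij by auto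
  qed (use that ij le in auto)
  moreover have "(i', j' - 1) = p" if "j < j'"
  proof (rule above)
    have "(i', j' - 1) \<in> insert q (insert p M)"
      using down[OF N, of i' j' i' "j' - 1"] that ij le ge by auto
    then show "(i', j' - 1) \<in> insert p M" using that ij by auto
  qed (use that ij le in auto)
  ultimately show ?thesis using ij le q by (cases "i < i'"; cases "j < j'") auto
qed

lemma opposite_hook_cells:
  assumes "opposite d d'" "q = (Suc (fst p), snd p) \<or> q = (fst p, Suc (snd p))"
  obtains r j where "p = line_cell d r j" "q = line_cell d (Suc r) j"
  | r j where "p = line_cell d' r j" "q = line_cell d' (Suc r) j"
proof -
  have *: "\<And>a b. line_cell d' a b = line_cell d b a" using assms(1) by (simp add: opposite_def)
  show thesis
    using assms(2) that(1)[of "fst p" "snd p"] that(2)[of "snd p" "fst p"]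
      that(1)[of "snd p" "fst p"] that(2)[of "fst p" "snd p"]
    unfolding * by (cases d) auto
qed

text \<open>One step of both orders of application, which have produced the same diagram
  \<open>N\<close> so far; \<open>t\<close> and \<open>t'\<close> mark occurrences at this step,
  \<open>b\<close> and \<open>b'\<close> past ones.\<close>

definition link_step :: "letter \<Rightarrow> letter \<Rightarrow> bool \<Rightarrow> bool \<Rightarrow> cell option \<Rightarrow>
    cell set \<Rightarrow> cell set \<Rightarrow> cell set \<Rightarrow> cell set \<Rightarrow> bool \<Rightarrow> bool \<Rightarrow> bool" where
  "link_step d d' t t' x M N1 N2 N b b' \<longleftrightarrow>
     emit d' t' N (emit d t N1 x) = emit d t N (emit d' t' N2 x) \<and>
     linked (set_option x \<union> M) (set_option (emit d t N1 x) \<union> N1) (set_option (emit d' t' N2 x) \<union> N2)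
       (set_option (emit d t N (emit d' t' N2 x)) \<union> N) (b \<or> t) (b' \<or> t')"

lemma link_step_sym:
  "link_step d d' t t' x M N1 N2 N b b' \<Longrightarrow> link_step d' d t' t x M N2 N1 N b' b"
  unfolding link_step_def using linked_sym by auto

lemma link_step_pass:
  assumes "linked M N1 N2 N b b'" "c \<notin> N" "N1 \<subseteq> N" "N2 \<subseteq> N"
  shows "link_step d d' False False (Some c) M N1 N2 N b b'"
proof -
  have "c \<notin> N1" "c \<notin> N2" using assms by auto
  then have "link_step d d' False False (Some c) M N1 N2 N b b' \<longleftrightarrow>
      linked (insert c M) (insert c N1) (insert c N2) (insert c N) b b'"
    using assms(2) by (simp add: link_step_def emit_def)
  moreover have "linked (insert c M) (insert c N1) (insert c N2) (insert c N) b b'"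
  proof -
    from assms(1) consider
      (free) x y where "(x \<noteq> None) = b" "(y \<noteq> None) = b'" "N1 = set_option x \<union> M"
        "N2 = set_option y \<union> M" "N = set_option x \<union> set_option y \<union> M" "set_option x \<inter> M = {}"
        "set_option y \<inter> M = {}" "set_option x \<inter> set_option y = {}"
      | (nested) p q where "b" "b'" "N1 = insert p M" "N2 = insert p M" "N = insert q (insert p M)"
        "p \<notin> M" "q \<notin> insert p M" "fst p \<le> fst q" "snd p \<le> snd q"
      unfolding linked_def by blast
    then show ?thesis
    proof cases
      case free
      then show ?thesis
        unfolding linked_def using assms(2) by (intro disjI1 exI[of _ x] exI[of _ y]) simp
    next
      case nested
      then show ?thesis
        unfolding linked_def using assms(2) by (intro disjI2 conjI exI[of _ p] exI[of _ q]) auto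
    qed
  qed
  ultimately show ?thesis by blast
qed

lemma link_step_trigger:
  assumes "opposite d d'" "diagram M" "diagram N" "linked M N1 N2 N False b"
  shows "link_step d d' True False None M N1 N2 N False b"
  using trigger_step[OF assms] by (simp add: link_step_def)

lemma link_step_bump:
  assumes opp: "opposite d d'" and N2: "diagram N2" and N: "diagram N" and K: "diagram (insert c M)"
    and c: "c \<notin> M" and y: "set_option y \<inter> insert c M = {}"
    and N1: "N1 = insert c M" and N2_eq: "N2 = set_option y \<union> M" and N_eq: "N = insert c N2"
    and b: "b' = (y \<noteq> None)"
  shows "link_step d d' False False (Some c) M N1 N2 N True b'"
  using bump_step[OF assms(1-9)] b by (simp add: link_step_def)

text \<open>An input cell outside \<open>N\<close> passes unchanged. One inside \<open>N\<close>
  either displaces a letter that holds it in both orders or is the inner cell of a nested pair;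
  \<open>bump_step\<close> and \<open>hook_step\<close> treat these.\<close>

lemma link_step:
  assumes opp: "opposite d d'" and M: "diagram M" and N1: "diagram N1" and N2: "diagram N2"
    and N: "diagram N" and sub: "N1 \<subseteq> N" "N2 \<subseteq> N"
    and link: "linked M N1 N2 N b b'"
    and trig: "t \<Longrightarrow> \<not> b \<and> \<not> t' \<and> x = None" "t' \<Longrightarrow> \<not> b' \<and> \<not> t \<and> x = None"
    and x: "\<And>c. x = Some c \<Longrightarrow> c \<notin> M \<and> diagram (insert c M)"
  shows "link_step d d' t t' x M N1 N2 N b b'"
proof (cases x)
  case None
  consider "t" "\<not> t'" "\<not> b" | "t'" "\<not> t" "\<not> b'" | "\<not> t" "\<not> t'" using trig by blast
  then show ?thesis
  proof cases
    case 1
    then show ?thesis using link_step_trigger[OF opp M N] link None by simp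
  next
    case 2
    then show ?thesis
      using link_step_trigger[OF opposite_sym[OF opp] M N] linked_sym[OF link] None link_step_sym by simp
  next
    case 3
    then show ?thesis using None link by (simp add: link_step_def emit_def)
  qed
next
  case (Some c)
  have c: "c \<notin> M" "diagram (insert c M)" using x Some by auto
  have nt: "\<not> t" "\<not> t'" using trig Some by auto
  show ?thesis
  proof (cases "c \<in> N")
    case False
    then show ?thesis using link_step_pass[OF link False sub] nt Some by simp
  next
    case True
    from link consider
      (free) x y where "(x \<noteq> None) = b" "(y \<noteq> None) = b'" "N1 = set_option x \<union> M"
        "N2 = set_option y \<union> M" "N = set_option x \<union> set_option y \<union> M" "set_option x \<inter> M = {}"
        "set_option y \<inter> M = {}" "set_option x \<inter> set_option y = {}"
      | (nested) p q where "b" "b'" "N1 = insert p M" "N2 = insert p M" "N = insert q (insert p M)"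
        "p \<notin> M" "q \<notin> insert p M" "fst p \<le> fst q" "snd p \<le> snd q"
      unfolding linked_def by blast
    then show ?thesis
    proof cases
      case free
      consider "x = Some c" | "y = Some c" using True free(5) c(1) by auto
      then show ?thesis
      proof cases
        case 1
        then have "link_step d d' False False (Some c) M N1 N2 N True b'"
          using free c by (intro link_step_bump[OF opp N2 N, of c M y]) auto
        then show ?thesis using nt Some free(1) 1 by simp
      next
        case 2
        then have "link_step d' d False False (Some c) M N2 N1 N True b"
          using free c by (intro link_step_bump[OF opposite_sym[OF opp] N1 N, of c M x]) auto
        then show ?thesis using nt Some free(2) 2 link_step_sym by simp
      qed
    next
      case nested
      have K: "diagram (insert p M)" using N1 nested by simp
      \<comment> \<open>The outer cell cannot be taken first: a diagram containing \<open>q\<close>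
        contains the componentwise smaller \<open>p\<close>.\<close>
      have "1 \<le> fst p" "1 \<le> snd p" using diagram_ge1[OF K, of "T 0" "fst p" "snd p"] by auto
      then have "p \<in> insert q M" if "diagram (insert q M)"
        using diagram_down[OF that, of "T 0" "fst q" "snd q" "fst p" "snd p"] nested(8,9) by simp
      then have "c \<noteq> q" using c(2) nested(6,7) by auto
      then have cp: "c = p" using True c(1) nested(5) by auto
      have Nd: "diagram (insert q (insert p M))" using N nested by simp
      have "q = (Suc (fst p), snd p) \<or> q = (fst p, Suc (snd p))"
        using adjacent_cells[OF K Nd nested(6-9) M] .
      from opposite_hook_cells[OF opp this]
      have "link_step d d' False False (Some p) M N1 N2 N b b'"
      proof cases
        case (1 r j)
        then show ?thesis
          using hook_step[OF opp K Nd nested(7) insertI1 1] nested by (simp add: link_step_def)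
      next
        case (2 r j)
        then have "link_step d' d False False (Some p) M N2 N1 N b' b"
          using hook_step[OF opposite_sym[OF opp] K Nd nested(7) insertI1 2] nested
          by (simp add: link_step_def)
        then show ?thesis by (rule link_step_sym)
      qed
      then show ?thesis using nt Some cp by simp
    qed
  qed
qed

section \<open>Commutation of whole operators\<close>

lemma run_singletons_commute:
  assumes opp: "opposite d d'" and e: "valid e" and s: "e s = None" "e s' = None" "s \<noteq> s'"
  shows "run d' {s'} (run d {s} e) = run d {s} (run d' {s'} e)"
proof -
  let ?e1 = "run d {s} e" and ?e2 = "run d' {s'} e"
  let ?A = "run d' {s'} ?e1" and ?B = "run d {s} ?e2"
  have v: "valid ?e1" "valid ?e2" using valid_run[OF e] by auto
  note s1 = strip_run[OF e, of d _ "{s}"] and s2 = strip_run[OF e, of d' _ "{s'}"]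
  note sA = strip_run[OF v(1), of d' _ "{s'}"] and sB = strip_run[OF v(2), of d _ "{s}"]
  have "cells ?A t = cells ?B t \<and> (\<forall>u < t. ?A u = ?B u) \<and>
    linked (cells e t) (cells ?e1 t) (cells ?e2 t) (cells ?B t) (s < t) (s' < t)" for t
  proof (induction t)
    case 0
    show ?case unfolding linked_def by simp
  next
    case (Suc t)
    then have eq: "cells ?A t = cells ?B t" and link:
      "linked (cells e t) (cells ?e1 t) (cells ?e2 t) (cells ?B t) (s < t) (s' < t)" by auto
    have sub: "cells ?e1 t \<subseteq> cells ?B t" "cells ?e2 t \<subseteq> cells ?B t"
      using stripD(3)[OF sA, of t] stripD(3)[OF sB, of t] eq by auto
    have "link_step d d' (t \<in> {s}) (t \<in> {s'}) (e t) (cells e t) (cells ?e1 t) (cells ?e2 t) (cells ?B t)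
        (s < t) (s' < t)"
      by (rule link_step[OF opp stripD(1)[OF s1] stripD(2)[OF s1] stripD(2)[OF s2] stripD(2)[OF sB]
            sub link]) (use s valid_cellsD[OF e] in auto)
    then have L: "?A t = ?B t"
      "linked (cells e (Suc t)) (cells ?e1 (Suc t)) (cells ?e2 (Suc t)) (cells ?B (Suc t))
        (s < t \<or> t \<in> {s}) (s' < t \<or> t \<in> {s'})"
      unfolding link_step_def cells_Suc
        run_eq[of d "{s}" e t, symmetric] run_eq[of d' "{s'}" e t, symmetric]
        run_eq[of d "{s}" ?e2 t, symmetric] run_eq[of d' "{s'}" ?e1 t, folded eq, symmetric]
      using run_eq[of d' "{s'}" ?e1 t] eq by auto
    have "(s < Suc t) = (s < t \<or> t \<in> {s})" "(s' < Suc t) = (s' < t \<or> t \<in> {s'})" by auto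
    then show ?case using L Suc by (auto simp: less_Suc_eq cells_Suc)
  qed
  then show ?thesis by (intro ext) (metis lessI)
qed

lemma run_single_commute:
  assumes opp: "opposite d d'" and "finite S" and e: "valid e" and s: "e s = None" "s \<notin> S"
    and S: "S \<inter> dom e = {}"
  shows "run d {s} (run d' S e) = run d' S (run d {s} e)"
  using \<open>finite S\<close> s(2) S
proof (induction S rule: finite_linorder_max_induct)
  case empty
  then show ?case using run_empty e valid_run by simp
next
  case (insert s' S)
  have "s' \<notin> dom e" "s' \<notin> dom (run d {s} e)" "s \<notin> dom (run d' S e)" "s' \<notin> dom (run d' S e)"
    using insert s(1) unfolding dom_run by auto
  then have none: "e s' = None" "run d {s} e s' = None" "run d' S e s = None" "run d' S e s' = None"
    unfolding domIff by auto
  have "run d {s} (run d' (insert s' S) e) = run d {s} (run d' {s'} (run d' S e))"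
    using run_insert_max[OF e] insert none by auto
  also have "\<dots> = run d' {s'} (run d {s} (run d' S e))"
    using run_singletons_commute[OF opp valid_run[OF e] none(3,4)] insert.prems by auto
  also have "\<dots> = run d' {s'} (run d' S (run d {s} e))"
    using insert by auto
  also have "\<dots> = run d' (insert s' S) (run d {s} e)"
    using run_insert_max[OF valid_run[OF e]] insert none by auto
  finally show ?case .
qed

text \<open>The occurrences of \<open>d\<close> are split off one by one, the latest first, and each
  is moved past the operator of \<open>d'\<close>. Disjointness of the times keeps every step down
  to a single event.\<close>

lemma run_commute:
  assumes opp: "opposite d d'" and fin: "finite R" "finite S" and e: "valid e"
    and disj: "R \<inter> S = {}" "R \<inter> dom e = {}" "S \<inter> dom e = {}"
  shows "run d R (run d' S e) = run d' S (run d R e)"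
  using fin(1) disj(1,2)
proof (induction R rule: finite_linorder_max_induct)
  case empty
  then show ?case using run_empty e valid_run by simp
next
  case (insert s R)
  have "s \<notin> dom e" "s \<notin> dom (run d R e)" "s \<notin> dom (run d' S e)" and dom: "S \<inter> dom (run d R e) = {}"
    using insert disj(3) unfolding dom_run by auto
  then have none: "e s = None" "run d R e s = None" "run d' S e s = None" "S \<inter> dom (run d R e) = {}"
    unfolding domIff by auto
  have "run d (insert s R) (run d' S e) = run d {s} (run d R (run d' S e))"
    using run_insert_max[OF valid_run[OF e]] insert none by auto
  also have "\<dots> = run d {s} (run d' S (run d R e))"
    using insert by auto
  also have "\<dots> = run d' S (run d {s} (run d R e))"
    using run_single_commute[OF opp fin(2) valid_run[OF e] none(2) _ none(4)] insert by auto
  also have "\<dots> = run d' S (run d (insert s R) e)"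
    using run_insert_max[OF e] insert none by auto
  finally show ?case .
qed

section \<open>The insertion algorithm on streams\<close>

definition below :: "(letter \<times> letter) set \<Rightarrow> letter filling \<Rightarrow> letter \<Rightarrow> cell set" where
  "below A P w = {c. \<exists>z. P c = Some z \<and> (z, w) \<in> A}"

definition upto_letter :: "(letter \<times> letter) set \<Rightarrow> letter filling \<Rightarrow> letter \<Rightarrow> cell set" where
  "upto_letter A P w = {c. \<exists>z. P c = Some z \<and> ((z, w) \<in> A \<or> z = w)}"

locale letter_order =
  fixes L :: "letter set" and A :: "(letter \<times> letter) set"
  assumes fin: "finite L" and sub: "A \<subseteq> L \<times> L" and linear: "strict_linear_order_on L A"
begin

lemma trans: "(x, y) \<in> A \<Longrightarrow> (y, z) \<in> A \<Longrightarrow> (x, z) \<in> A"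
  using linear unfolding strict_linear_order_on_def trans_def by blast

lemma irrefl: "(x, x) \<notin> A"
  using linear unfolding strict_linear_order_on_def irrefl_def by blast

lemma total: "x \<in> L \<Longrightarrow> y \<in> L \<Longrightarrow> x = y \<or> (x, y) \<in> A \<or> (y, x) \<in> A"
  using linear unfolding strict_linear_order_on_def total_on_def by blast

text \<open>Gives induction along a bumping route, since each bumped letter is
  \<open>A\<close>-greater than the letter that bumps it.\<close>

lemma wf_converse: "wf (A\<inverse>)"
proof (rule finite_acyclic_wf_converse)
  show "finite A" using finite_subset[OF sub] fin by simp
  have "trans A" "irrefl A" using linear unfolding strict_linear_order_on_def by auto
  then show "acyclic A" unfolding acyclic_irrefl by simp
qed

text \<open>Semistandard with respect to \<open>A\<close>: along the chain of diagrams cut out by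
  the order, the cells of each t-letter form a horizontal strip, those of each u-letter a vertical
  strip.\<close>

definition tableau :: "letter filling \<Rightarrow> bool" where
  "tableau P \<longleftrightarrow> ran P \<subseteq> L \<and> diagram (dom P) \<and>
     (\<forall>w \<in> L. strip w (below A P w) (upto_letter A P w))"

text \<open>The condition under which \<open>y\<close>, bumped into line \<open>m\<close>, keeps its own cells a strip.\<close>

definition fits :: "letter filling \<Rightarrow> letter \<Rightarrow> nat \<Rightarrow> bool" where
  "fits P y m \<longleftrightarrow> 1 \<le> m \<and> (\<exists>q. line_end y (upto_letter A P y) m = line_cell y m q \<and>
     (m = 1 \<or> line_cell y (m - 1) q \<in> below A P y))"

lemma upto_subset_below: "(y, w) \<in> A \<Longrightarrow> upto_letter A P y \<subseteq> below A P w"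
  unfolding below_def upto_letter_def using trans by blast

lemma upto_subset_dom: "upto_letter A P w \<subseteq> dom P"
  unfolding upto_letter_def by blast

lemma tableauD:
  assumes "tableau P" "w \<in> L"
  shows "strip w (below A P w) (upto_letter A P w)" "diagram (below A P w)"
    "diagram (upto_letter A P w)"
  using assms stripD(1,2)[of w "below A P w" "upto_letter A P w"] unfolding tableau_def by auto

text \<open>By hypothesis \<open>y\<close> overwrites only a larger letter, so the diagrams cut out
  by the order never lose a cell.\<close>

lemma below_update:
  assumes "\<And>z. P c = Some z \<Longrightarrow> (y, z) \<in> A"
  shows "below A (P(c \<mapsto> y)) w = (if (y, w) \<in> A then insert c (below A P w) else below A P w)"
proof -
  have "c \<notin> below A P w" if "(y, w) \<notin> A"
    using that assms trans unfolding below_def by blast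
  then show ?thesis unfolding below_def by auto
qed

lemma upto_update:
  assumes "\<And>z. P c = Some z \<Longrightarrow> (y, z) \<in> A"
  shows "upto_letter A (P(c \<mapsto> y)) w =
    (if (y, w) \<in> A \<or> y = w then insert c (upto_letter A P w) else upto_letter A P w)"
proof -
  have "c \<notin> upto_letter A P w" if "(y, w) \<notin> A"
    using that assms trans unfolding upto_letter_def by blast
  then show ?thesis unfolding upto_letter_def by auto
qed

text \<open>For the strip of \<open>y\<close> itself, \<open>fits\<close> provides the condition.
  For a larger letter both diagrams receive \<open>c\<close>; for a smaller one neither
  changes.\<close>

lemma tableau_update:
  assumes P: "tableau P" and y: "y \<in> L" and fits: "fits P y m"
    and c: "c = line_end y (upto_letter A P y) m" and bump: "\<And>z. P c = Some z \<Longrightarrow> (y, z) \<in> A"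
  shows "tableau (P(c \<mapsto> y))"
proof -
  obtain q where q: "line_end y (upto_letter A P y) m = line_cell y m q" "1 \<le> m"
    "m = 1 \<or> line_cell y (m - 1) q \<in> below A P y"
    using fits unfolding fits_def by blast
  have st: "strip y (below A P y) (insert c (upto_letter A P y))"
    using strip_insert_upper[OF tableauD(1)[OF P y] q(2,1,3)] c q(1) by simp
  note D = stripD(2)[OF st]
  have ext: "diagram (insert c E)" if "diagram E" "upto_letter A P y \<subseteq> E" for E
  proof -
    have "insert c E = insert c (upto_letter A P y) \<union> E" using that by blast
    then show ?thesis using diagram_Un[OF D that(1)] by simp
  qed
  have "strip w (below A (P(c \<mapsto> y)) w) (upto_letter A (P(c \<mapsto> y)) w)" if w: "w \<in> L" for w
  proof (cases "(y, w) \<in> A")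
    case True
    then have "strip w (insert c (below A P w)) (insert c (upto_letter A P w))"
      using strip_insert_both[OF tableauD(1)[OF P w]] ext[OF tableauD(2)[OF P w]]
        upto_subset_below[OF True] by blast
    then show ?thesis using True below_update[OF bump] upto_update[OF bump] by simp
  next
    case False
    then show ?thesis
      using st tableauD(1)[OF P w] below_update[OF bump] upto_update[OF bump] by auto
  qed
  moreover have "diagram (dom (P(c \<mapsto> y)))"
    using ext[of "dom P"] upto_subset_dom P unfolding tableau_def by simp
  moreover have "ran (P(c \<mapsto> y)) \<subseteq> L"
    using P y unfolding tableau_def ran_def by auto
  ultimately show ?thesis unfolding tableau_def by blast
qed

lemma bumpable_iff:
  assumes P: "tableau P" and y: "y \<in> L"
  shows "bumpable A P y m p \<longleftrightarrow>
    1 \<le> p \<and> line_cell y m p \<in> dom P \<and> line_cell y m p \<notin> upto_letter A P y"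
proof -
  have "(y, z) \<in> A \<longleftrightarrow> (z, y) \<notin> A \<and> z \<noteq> y" if "P c = Some z" for c z
  proof -
    have "z \<in> L" using that P unfolding tableau_def by (auto simp: ran_def)
    then show ?thesis using total[OF y, of z] irrefl trans by blast
  qed
  then show ?thesis unfolding bumpable_def upto_letter_def dom_def
    by (smt (verit) mem_Collect_eq option.discI option.inject not_Some_eq)
qed

text \<open>In line \<open>m\<close> the entries up to \<open>y\<close> fill an initial segment. The
  cell \<open>c\<close> after it contains the first larger entry or, if there is none, is the first
  free cell; thus \<open>line_end\<close> describes both branches of the algorithm.\<close>

lemma insertion_position:
  assumes P: "tableau P" and y: "y \<in> L" and m: "1 \<le> m"
    and c: "c = line_end y (upto_letter A P y) m"
  shows "(\<exists>p. bumpable A P y m p) \<longleftrightarrow> c \<in> dom P"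
    and "c \<in> dom P \<Longrightarrow> line_cell y m (LEAST p. bumpable A P y m p) = c"
    and "c \<notin> dom P \<Longrightarrow> line_cell y m (LEAST p. 1 \<le> p \<and> P (line_cell y m p) = None) = c"
proof -
  note D = tableauD(3)[OF P y]
  have dom: "diagram (dom P)" using P unfolding tableau_def by blast
  obtain q where q: "c = line_cell y m q" "1 \<le> q" "line_cell y m q \<notin> upto_letter A P y"
    "\<And>p. 1 \<le> p \<Longrightarrow> p < q \<Longrightarrow> line_cell y m p \<in> upto_letter A P y"
    using line_end_ex[OF D, of y m] c by blast
  have least: "q \<le> p" if "1 \<le> p" "line_cell y m p \<notin> upto_letter A P y" for p
    using that q(4)[of p] by force
  show *: "(\<exists>p. bumpable A P y m p) \<longleftrightarrow> c \<in> dom P"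
  proof
    assume "\<exists>p. bumpable A P y m p"
    then obtain p where p: "1 \<le> p" "line_cell y m p \<in> dom P" "line_cell y m p \<notin> upto_letter A P y"
      using bumpable_iff[OF P y] by blast
    then show "c \<in> dom P" using diagram_down[OF dom p(2) m _ q(2)] least q(1) by simp
  next
    assume "c \<in> dom P"
    then show "\<exists>p. bumpable A P y m p" using bumpable_iff[OF P y] q by blast
  qed
  show "line_cell y m (LEAST p. bumpable A P y m p) = c" if "c \<in> dom P"
  proof -
    have "(LEAST p. bumpable A P y m p) = q"
      by (rule Least_equality) (use bumpable_iff[OF P y] q that least in auto)
    then show ?thesis using q by simp
  qed
  show "line_cell y m (LEAST p. 1 \<le> p \<and> P (line_cell y m p) = None) = c" if "c \<notin> dom P"
  proof -
    have "(LEAST p. 1 \<le> p \<and> P (line_cell y m p) = None) = q"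
    proof (rule Least_equality)
      show "1 \<le> q \<and> P (line_cell y m q) = None" using q that by auto
      fix p assume "1 \<le> p \<and> P (line_cell y m p) = None"
      moreover have "line_cell y m p \<notin> upto_letter A P y"
        using calculation unfolding upto_letter_def by simp
      ultimately show "q \<le> p" using least by blast
    qed
    then show ?thesis using q by simp
  qed
qed

section \<open>A complete insertion and its bumping route\<close>

lemma insert_line_step:
  assumes "tableau P" "y \<in> L" "1 \<le> m" "c = line_end y (upto_letter A P y) m"
  shows "insert_line A P y m =
    (case P c of None \<Rightarrow> (P(c \<mapsto> y), c) | Some z \<Rightarrow> insert_line A (P(c \<mapsto> y)) z (next_line z c))"
  using insertion_position[OF assms]
  by (subst insert_line.simps) (auto simp: Let_def domIff split: option.splits)

text \<open>The argument of \<open>strip_bump\<close> again: \<open>z\<close> lands weakly before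
  its old place, and the cell of its old line at the landing place is by then occupied by a smaller
  letter.\<close>

lemma fits_bumped:
  assumes P: "tableau P" and y: "y \<in> L" and c: "P c = Some z" and yz: "(y, z) \<in> A"
    and P': "tableau (P(c \<mapsto> y))"
  shows "fits (P(c \<mapsto> y)) z (next_line z c)"
proof -
  have z: "z \<in> L" using yz sub by blast
  have upd: "below A (P(c \<mapsto> y)) z = insert c (below A P z)"
    "upto_letter A (P(c \<mapsto> y)) z = upto_letter A P z"
    using below_update[of P c y z] upto_update[of P c y z] c yz
    by (auto simp: upto_letter_def)
  obtain r k where rk: "c = line_cell z r k" by (rule line_cell_cases)
  have cz: "c \<in> upto_letter A P z" "c \<notin> below A P z"
    using c irrefl unfolding upto_letter_def below_def by auto
  obtain q where q: "line_end z (upto_letter A P z) (Suc r) = line_cell z (Suc r) q" "1 \<le> q"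
    using line_end_ex[OF tableauD(3)[OF P z], of z "Suc r"] by blast
  have "q \<le> k" using strip_bump_place[OF tableauD(1)[OF P z] _ _ q(1)] cz rk by blast
  have D: "diagram (insert c (below A P z))" using tableauD(2)[OF P' z] upd by simp
  have "line_cell z r k \<in> insert c (below A P z)" using rk by simp
  moreover have "1 \<le> r" using diagram_ge1[OF D calculation] by simp
  ultimately have "line_cell z r q \<in> insert c (below A P z)"
    using diagram_down[OF D, of z r k r q] \<open>q \<le> k\<close> q(2) by simp
  then show ?thesis unfolding fits_def using q rk upd by auto
qed

text \<open>The insertion of \<open>y\<close> into line \<open>m\<close> as seen from the letter
  \<open>w\<close>. The third clause is the rule of \<open>emit\<close> for the cell
  \<open>c\<close> gained by the smaller letters; for \<open>m = 1\<close> the second clause is its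
  rule for an occurrence.\<close>

definition grows_from :: "letter filling \<Rightarrow> letter filling \<Rightarrow> letter \<Rightarrow> nat \<Rightarrow> letter \<Rightarrow> bool" where
  "grows_from P P' y m w \<longleftrightarrow>
     ((w, y) \<in> A \<longrightarrow> below A P' w = below A P w \<and> upto_letter A P' w = upto_letter A P w) \<and>
     (w = y \<longrightarrow> below A P' w = below A P w \<and>
        upto_letter A P' w = insert (line_end y (upto_letter A P y) m) (upto_letter A P w)) \<and>
     ((y, w) \<in> A \<longrightarrow> (\<exists>c. c \<notin> below A P w \<and> below A P' w = insert c (below A P w) \<and>
        upto_letter A P' w =
          insert (if c \<in> upto_letter A P w then line_end w (upto_letter A P w) (next_line w c) else c)
            (upto_letter A P w)))"

lemma insert_line_grows:
  assumes "tableau P" "y \<in> L" "fits P y m" "insert_line A P y m = (P', c')"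
  shows "tableau P' \<and> c' \<notin> dom P \<and> dom P' = insert c' (dom P) \<and> (\<forall>w \<in> L. grows_from P P' y m w)"
  using assms
proof (induction y arbitrary: P m rule: wf_induct_rule[OF wf_converse])
  case (1 y)
  note P = 1(2) and y = 1(3) and fits = 1(4) and ins = 1(5)
  define c where "c = line_end y (upto_letter A P y) m"
  have m: "1 \<le> m" using fits unfolding fits_def by simp
  have ctab: "c \<notin> upto_letter A P y" using line_end_notin[OF tableauD(3)[OF P y]] c_def by simp
  have bump: "(y, z) \<in> A" if "P c = Some z" for z
  proof -
    have "z \<in> L" using that P unfolding tableau_def by (auto simp: ran_def)
    then show ?thesis using total[OF y, of z] ctab that unfolding upto_letter_def by auto
  qed
  define P1 where "P1 = P(c \<mapsto> y)"
  have tab1: "tableau P1" unfolding P1_def using tableau_update[OF P y fits c_def bump] .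
  have upd: "below A P1 w = (if (y, w) \<in> A then insert c (below A P w) else below A P w)"
    "upto_letter A P1 w =
      (if (y, w) \<in> A \<or> y = w then insert c (upto_letter A P w) else upto_letter A P w)" for w
    unfolding P1_def using below_update[OF bump] upto_update[OF bump] by auto
  have dom1: "dom P1 = insert c (dom P)" by (simp add: P1_def)
  have asym: "(w, y) \<in> A \<Longrightarrow> (y, w) \<notin> A" for w y using trans irrefl by blast
  show ?case
  proof (cases "P c")
    case None
    then have "P' = P1" "c' = c" using insert_line_step[OF P y m c_def] ins by (auto simp: P1_def)
    moreover have "c \<notin> below A P w" "c \<notin> upto_letter A P w" for w
      using None unfolding below_def upto_letter_def by auto
    moreover have "grows_from P P1 y m w" for w
      unfolding grows_from_def upd c_def[symmetric] using calculation(3,4) asym[of w y] irrefl by auto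
    ultimately show ?thesis
      using tab1 dom1 None by (simp add: domIff)
  next
    case (Some z)
    have yz: "(y, z) \<in> A" using bump[OF Some] .
    then have z: "z \<in> L" using sub by blast
    have "insert_line A P1 z (next_line z c) = (P', c')"
      using insert_line_step[OF P y m c_def] ins Some by (simp add: P1_def)
    from 1(1)[OF _ tab1 z fits_bumped[OF P y Some yz tab1[unfolded P1_def], folded P1_def] this] yz
    have IH: "tableau P'" "c' \<notin> dom P1" "dom P' = insert c' (dom P1)"
      "\<forall>w \<in> L. grows_from P1 P' z (next_line z c) w" by auto
    have "grows_from P P' y m w" if w: "w \<in> L" for w
    proof -
      note g = IH(4)[rule_format, OF w, unfolded grows_from_def]
      have cz: "c \<notin> below A P z" "c \<in> upto_letter A P z"
        using Some irrefl unfolding below_def upto_letter_def by auto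
      \<comment> \<open>Letters strictly between \<open>y\<close> and \<open>z\<close> gain
        \<open>c\<close> and nothing later. For \<open>z\<close> itself, \<open>c\<close> passes
        from its own cells to those of smaller letters. Letters above \<open>z\<close> had counted
        \<open>c\<close> already, so only the recursive insertion affects them.\<close>
      consider "(w, y) \<in> A" | "w = y" | "(y, w) \<in> A" "(w, z) \<in> A" | "w = z" | "(z, w) \<in> A"
        using total w y z by metis
      then show ?thesis
      proof cases
        case 1
        then show ?thesis
          using g trans[OF 1 yz] upd[of w] asym irrefl unfolding grows_from_def by metis
      next
        case 2
        then show ?thesis
          using g yz upd[of w] irrefl unfolding grows_from_def c_def by auto
      next
        case 3
        have "c \<notin> below A P w" "c \<notin> upto_letter A P w"
          using Some 3 asym irrefl unfolding below_def upto_letter_def by auto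
        then show ?thesis
          using g 3 upd[of w] asym irrefl unfolding grows_from_def by auto
      next
        case 4
        then show ?thesis
          using g cz yz upd[of w] asym irrefl unfolding grows_from_def
          by (auto simp: insert_absorb)
      next
        case 5
        have "c \<in> below A P w" "c \<in> upto_letter A P w"
          using Some 5 unfolding below_def upto_letter_def by auto
        moreover have "(y, w) \<in> A" using trans[OF yz 5] .
        ultimately have "below A P1 w = below A P w" "upto_letter A P1 w = upto_letter A P w"
          using upd[of w] by auto
        then show ?thesis
          using g 5 \<open>(y, w) \<in> A\<close> asym irrefl unfolding grows_from_def by auto
      qed
    qed
    moreover have "c \<in> dom P" using Some by auto
    ultimately show ?thesis using IH dom1 by (simp add: insert_absorb)
  qed
qed

end

section \<open>Independence of the shuffle\<close>

definition occurrences :: "letter list \<Rightarrow> letter \<Rightarrow> nat set" where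
  "occurrences v w = {s. s < length v \<and> v ! s = w}"

definition level :: "letter list \<Rightarrow> letter \<Rightarrow> (nat \<Rightarrow> cell option) \<Rightarrow> nat \<Rightarrow> cell option" where
  "level v w = run w (occurrences v w)"

lemma finite_occurrences: "finite (occurrences v w)"
  by (simp add: occurrences_def)

lemma occurrences_disjoint: "w \<noteq> w' \<Longrightarrow> occurrences v w \<inter> occurrences v w' = {}"
  by (auto simp: occurrences_def)

lemma valid_level: "valid e \<Longrightarrow> valid (level v w e)"
  by (simp add: level_def valid_run)

lemma valid_fold_level: "valid e \<Longrightarrow> valid (fold (level v) ws e)"
  by (induction ws arbitrary: e) (auto simp: valid_level)

lemma dom_level: "dom (level v w e) = dom e \<union> occurrences v w"
  by (simp add: level_def dom_run)

lemma dom_fold_level: "dom (fold (level v) ws e) = dom e \<union> (\<Union>w \<in> set ws. occurrences v w)"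
  by (induction ws arbitrary: e) (auto simp: dom_level)

lemma cells_Suc_insertD:
  assumes "cells e (Suc t) = insert c (cells e t)" "c \<notin> cells e t"
  shows "e t = Some c"
proof -
  have "c \<in> set_option (e t) \<union> cells e t" using assms(1) cells_Suc[of e t] by blast
  then show ?thesis using assms(2) by simp
qed

lemma valid_None: "valid (\<lambda>_. None)"
  by (simp add: valid_def cells_def)

lemma level_fold_commute:
  assumes "valid e" "x \<notin> set us" "distinct us" "\<And>u. u \<in> set us \<Longrightarrow> opposite x u"
    "occurrences v x \<inter> dom e = {}" "\<And>u. u \<in> set us \<Longrightarrow> occurrences v u \<inter> dom e = {}"
  shows "level v x (fold (level v) us e) = fold (level v) us (level v x e)"
  using assms
proof (induction us arbitrary: e)
  case (Cons u us)
  have disj: "occurrences v x \<inter> occurrences v u = {}"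
    using Cons.prems(2) occurrences_disjoint by auto
  have "occurrences v w \<inter> dom (level v u e) = {}" if "w \<in> set us" for w
  proof -
    have "w \<noteq> u" using that Cons.prems(3) by auto
    then show ?thesis using that Cons.prems(6) occurrences_disjoint[of w u v] by (auto simp: dom_level)
  qed
  moreover have "occurrences v x \<inter> dom (level v u e) = {}"
    using disj Cons.prems(5) by (auto simp: dom_level)
  ultimately have "level v x (fold (level v) us (level v u e)) =
      fold (level v) us (level v x (level v u e))"
    using Cons.IH[of "level v u e"] Cons.prems valid_level by auto
  also have "level v x (level v u e) = level v u (level v x e)"
    unfolding level_def
    using run_commute[of x u "occurrences v x" "occurrences v u" e] Cons.prems disj
      finite_occurrences by auto
  finally show ?case by simp
qed simp

section \<open>Sorting the operators by kind\<close>

fun is_T :: "letter \<Rightarrow> bool" where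
  "is_T (T _) = True"
| "is_T (U _) = False"

text \<open>Induction on the last letter of the list: a u-letter already stands at the end, a
  t-letter is moved inwards past all u-letters. Letters of the same kind never change their relative
  order.\<close>

lemma fold_level_separate:
  assumes "valid e" "distinct ws" "\<And>w. w \<in> set ws \<Longrightarrow> occurrences v w \<inter> dom e = {}"
  shows "fold (level v) ws e =
    fold (level v) (filter (\<lambda>w. \<not> is_T w) ws) (fold (level v) (filter is_T ws) e)"
  using assms
proof (induction ws rule: rev_induct)
  case (snoc x ws)
  let ?us = "filter (\<lambda>w. \<not> is_T w) ws" and ?e = "fold (level v) (filter is_T ws) e"
  have IH: "fold (level v) ws e = fold (level v) ?us ?e" using snoc by auto
  show ?case
  proof (cases "is_T x")
    case True
    have "opposite x u" if "u \<in> set ?us" for u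
    proof -
      have "\<not> is_T u" using that by simp
      then show ?thesis using True by (cases x; cases u) (simp_all add: opposite_def)
    qed
    moreover have "occurrences v w \<inter> dom ?e = {}" if "w \<in> set ?us \<or> w = x" for w
    proof -
      have "w \<noteq> t" if "t \<in> set (filter is_T ws)" for t
        using that \<open>w \<in> set ?us \<or> w = x\<close> snoc.prems(2) by auto
      then have "occurrences v w \<inter> occurrences v t = {}" if "t \<in> set (filter is_T ws)" for t
        using that occurrences_disjoint by blast
      then show ?thesis using that snoc.prems(3)[of w] by (auto simp: dom_fold_level)
    qed
    ultimately have "level v x (fold (level v) ?us ?e) = fold (level v) ?us (level v x ?e)"
      using snoc.prems(1,2) by (intro level_fold_commute valid_fold_level) auto
    then show ?thesis using IH True by simp
  next
    case False
    then show ?thesis using IH by simp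
  qed
qed simp

text \<open>Both orders rank the letters of one kind by index, so pulling back along
  \<open>f\<close> turns both lists into the strictly increasing enumeration of
  \<open>S\<close>.\<close>

lemma sorted_enumeration_unique:
  assumes xs: "sorted_wrt (\<lambda>x y. (x, y) \<in> A) xs" "set xs = f ` S"
    and ys: "sorted_wrt (\<lambda>x y. (x, y) \<in> B) ys" "set ys = f ` S"
    and f: "inj f"
    and A: "\<And>i j. i \<in> S \<Longrightarrow> j \<in> S \<Longrightarrow> (f i, f j) \<in> A \<Longrightarrow> i < j"
    and B: "\<And>i j. i \<in> S \<Longrightarrow> j \<in> S \<Longrightarrow> (f i, f j) \<in> B \<Longrightarrow> i < (j :: nat)"
  shows "xs = ys"
proof -
  have enum: "sorted_wrt (<) (map (inv f) zs) \<and> set (map (inv f) zs) = S \<and> map f (map (inv f) zs) = zs"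
    if zs: "sorted_wrt (\<lambda>x y. (x, y) \<in> C) zs" "set zs = f ` S"
      and C: "\<And>i j. i \<in> S \<Longrightarrow> j \<in> S \<Longrightarrow> (f i, f j) \<in> C \<Longrightarrow> i < j" for C zs
  proof (intro conjI)
    have "inv f a < inv f b" if ab: "a \<in> set zs" "b \<in> set zs" and rel: "(a, b) \<in> C" for a b
    proof -
      obtain i j where ij: "a = f i" "b = f j" "i \<in> S" "j \<in> S"
        using ab unfolding zs(2) by (elim imageE)
      then have "i < j" using C[OF ij(3,4)] rel by simp
      then show ?thesis using ij f by simp
    qed
    then show "sorted_wrt (<) (map (inv f) zs)"
      unfolding sorted_wrt_map using sorted_wrt_mono_rel[OF _ zs(1)] by simp
    show "set (map (inv f) zs) = S"
      unfolding set_map zs(2) image_inv_f_f[OF f] ..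
    have "f (inv f a) = a" if "a \<in> set zs" for a
      using that f unfolding zs(2) by auto
    then show "map f (map (inv f) zs) = zs"
      by (simp add: map_idI)
  qed
  have X: "sorted_wrt (<) (map (inv f) xs)" "set (map (inv f) xs) = S" "map f (map (inv f) xs) = xs"
    using enum[OF xs A] by blast+
  have Y: "sorted_wrt (<) (map (inv f) ys)" "set (map (inv f) ys) = S" "map f (map (inv f) ys) = ys"
    using enum[OF ys B] by blast+
  have "map (inv f) xs = map (inv f) ys"
    using strict_sorted_equal[OF X(1) Y(1)] X(2) Y(2) by simp
  then show ?thesis using X(3) Y(3) by argo
qed

context letter_order
begin

lemma sorted_enumeration: "\<exists>ws. sorted_wrt (\<lambda>x y. (x, y) \<in> A) ws \<and> set ws = L"
proof -
  have "\<exists>ws. sorted_wrt (\<lambda>x y. (x, y) \<in> A) ws \<and> set ws = M" if "finite M" "M \<subseteq> L" for M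
    using that
  proof (induction M rule: finite_induct)
    case (insert x M)
    then obtain ws where ws: "sorted_wrt (\<lambda>x y. (x, y) \<in> A) ws" "set ws = M" by auto
    let ?lo = "filter (\<lambda>y. (y, x) \<in> A) ws" and ?hi = "filter (\<lambda>y. (x, y) \<in> A) ws"
    have "sorted_wrt (\<lambda>x y. (x, y) \<in> A) (?lo @ x # ?hi)"
      using ws(1) trans[of _ x] by (simp add: sorted_wrt_append sorted_wrt_filter)
    moreover have "set (?lo @ x # ?hi) = insert x M"
      using ws(2) total[of x] insert.prems insert.hyps(2) by auto
    ultimately show ?case by blast
  qed simp
  then show ?thesis using fin by blast
qed

end

section \<open>The streams of a word over a sorted alphabet\<close>

locale sorted_letters = letter_order +
  fixes ws :: "letter list" and v :: "letter list"
  assumes sorted: "sorted_wrt (\<lambda>x y. (x, y) \<in> A) ws" and set_ws: "set ws = L"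
    and word: "set v \<subseteq> L"
begin

text \<open>Meant as the stream of the part of the tableau filled by the \<open>j\<close> smallest
  letters; the operator of \<open>ws ! j\<close> leads from \<open>stage j\<close> to
  \<open>stage (Suc j)\<close>.\<close>

definition stage :: "nat \<Rightarrow> nat \<Rightarrow> cell option" where
  "stage j = fold (level v) (take j ws) (\<lambda>_. None)"

text \<open>Merges \<open>below\<close> and \<open>upto_letter\<close> into one family indexed by
  rank: for the letter \<open>ws ! j\<close> they are the members \<open>j\<close> and
  \<open>Suc j\<close>.\<close>

definition initial :: "letter filling \<Rightarrow> nat \<Rightarrow> cell set" where
  "initial P j = {c. \<exists>i < j. P c = Some (ws ! i)}"

lemma valid_stage: "valid (stage j)"
  unfolding stage_def using valid_fold_level valid_None by blast

lemma stage_Suc: "j < length ws \<Longrightarrow> stage (Suc j) = level v (ws ! j) (stage j)"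
  by (simp add: stage_def take_Suc_conv_app_nth)

lemma nth_less_iff:
  assumes "i < length ws" "j < length ws"
  shows "(ws ! i, ws ! j) \<in> A \<longleftrightarrow> i < j"
proof
  assume "i < j" then show "(ws ! i, ws ! j) \<in> A" using sorted assms sorted_wrt_nth_less by metis
next
  assume *: "(ws ! i, ws ! j) \<in> A"
  show "i < j"
  proof (rule ccontr)
    assume "\<not> i < j"
    then consider "i = j" | "j < i" by linarith
    then show False
    proof cases
      case 2
      then have "(ws ! j, ws ! i) \<in> A" using sorted assms sorted_wrt_nth_less by metis
      then show False using * trans irrefl by blast
    qed (use * irrefl in auto)
  qed
qed

lemma distinct_ws: "distinct ws"
  unfolding distinct_conv_nth using nth_less_iff irrefl by (metis nat_neq_iff)

lemma initial_0: "initial P 0 = {}"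
  by (simp add: initial_def)

lemma entry_index:
  assumes "tableau P" "P c = Some z"
  obtains i where "i < length ws" "z = ws ! i"
proof -
  have "z \<in> set ws" using assms set_ws unfolding tableau_def by (auto simp: ran_def)
  then show thesis using that by (auto simp: in_set_conv_nth)
qed

lemma below_initial:
  assumes "tableau P" "j < length ws"
  shows "below A P (ws ! j) = initial P j"
proof -
  have "(\<exists>z. P c = Some z \<and> (z, ws ! j) \<in> A) \<longleftrightarrow> (\<exists>i < j. P c = Some (ws ! i))" for c
    using entry_index[OF assms(1), of c] nth_less_iff assms(2) by (metis less_trans)
  then show ?thesis unfolding below_def initial_def by simp
qed

lemma upto_initial:
  assumes "tableau P" "j < length ws"
  shows "upto_letter A P (ws ! j) = initial P (Suc j)"
proof -
  have "upto_letter A P (ws ! j) = below A P (ws ! j) \<union> {c. P c = Some (ws ! j)}"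
    unfolding below_def upto_letter_def by blast
  also have "\<dots> = initial P (Suc j)"
    unfolding below_initial[OF assms] initial_def less_Suc_eq by blast
  finally show ?thesis .
qed

lemma initial_dom:
  assumes "tableau P"
  shows "initial P (length ws) = dom P"
proof -
  have "(\<exists>i < length ws. P c = Some (ws ! i)) \<longleftrightarrow> (\<exists>z. P c = Some z)" for c
    using entry_index[OF assms, of c] by metis
  then show ?thesis unfolding initial_def dom_def by (simp add: not_None_eq)
qed

text \<open>At the fixed time \<open>s\<close> the induction runs through the letters in increasing
  order. Since \<open>grows_from\<close> and \<open>emit\<close> express the same rule, agreement
  passes from the letters below \<open>w\<close> to those up to \<open>w\<close>.\<close>

lemma stage_step:
  assumes P: "tableau P" and P': "tableau P'" and s: "s < length v"
    and init: "\<And>j. j \<le> length ws \<Longrightarrow> initial P j = cells (stage j) s"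
    and grow: "\<And>w. w \<in> L \<Longrightarrow> grows_from P P' (v ! s) 1 w"
    and j: "j \<le> length ws"
  shows "initial P' j = cells (stage j) (Suc s)"
  using j
proof (induction j)
  case 0
  then show ?case by (simp add: initial_0 stage_def cells_def)
next
  case (Suc j)
  define w where "w = ws ! j"
  have j: "j < length ws" and w: "w \<in> L" using Suc.prems set_ws w_def by auto
  have b: "below A P w = cells (stage j) s" "below A P' w = cells (stage j) (Suc s)"
    using below_initial[OF P j] below_initial[OF P' j] init[of j] Suc w_def by auto
  have u: "upto_letter A P w = cells (stage (Suc j)) s" "upto_letter A P' w = initial P' (Suc j)"
    using upto_initial[OF P j] upto_initial[OF P' j] init[of "Suc j"] j w_def by auto
  have st: "stage (Suc j) s = emit w (v ! s = w) (cells (stage (Suc j)) s) (stage j s)"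
    using run_eq[of w "occurrences v w" "stage j" s] s
    unfolding stage_Suc[OF j] level_def w_def[symmetric] by (simp add: occurrences_def)
  have new: "stage j s = None" if "cells (stage j) (Suc s) = cells (stage j) s"
  proof (cases "stage j s")
    case (Some c)
    then have "c \<notin> cells (stage j) s" using valid_cellsD[OF valid_stage] by blast
    then show ?thesis using Some that by (auto simp: cells_Suc)
  qed
  note g = grow[OF w, unfolded grows_from_def b u(1)]
  consider "(w, v ! s) \<in> A" | "w = v ! s" | "(v ! s, w) \<in> A"
    using total[OF w, of "v ! s"] word s nth_mem by blast
  then show ?case
  proof cases
    case 1
    then have "v ! s \<noteq> w" "stage j s = None" using g new irrefl by auto
    then have "stage (Suc j) s = None" using st by (simp add: emit_def)
    then show ?thesis using 1 g u(2) by (simp add: cells_Suc)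
  next
    case 2
    then have "stage j s = None" using g new by auto
    then have "stage (Suc j) s = Some (line_end w (cells (stage (Suc j)) s) 1)"
      using st 2 by (simp add: emit_def)
    then show ?thesis using 2 g u by (simp add: cells_Suc)
  next
    case 3
    then obtain c where c: "c \<notin> cells (stage j) s"
      "cells (stage j) (Suc s) = insert c (cells (stage j) s)"
      "upto_letter A P' w = insert (if c \<in> cells (stage (Suc j)) s
         then line_end w (cells (stage (Suc j)) s) (next_line w c) else c) (cells (stage (Suc j)) s)"
      using g by blast
    have "stage j s = Some c" using cells_Suc_insertD[OF c(2,1)] .
    then show ?thesis using st c(3) u(2) by (simp add: cells_Suc emit_def)
  qed
qed

text \<open>The stream of the full alphabet lists the newly created cells, so it encodes the
  recording tableau. Stream times start at 0 but entries at 1, whence \<open>Suc t\<close>.\<close>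

lemma rsk_take:
  assumes "s \<le> length v"
  shows "\<exists>P Q. fold (rsk_step A) (enumerate 1 (take s v)) (Map.empty, Map.empty) = (P, Q) \<and>
    tableau P \<and> (\<forall>j \<le> length ws. initial P j = cells (stage j) s) \<and>
    (\<forall>c i. Q c = Some i \<longleftrightarrow> (\<exists>t < s. stage (length ws) t = Some c \<and> i = Suc t))"
  using assms
proof (induction s)
  case 0
  have "tableau Map.empty"
    by (simp add: tableau_def strip_def below_def upto_letter_def)
  then show ?case by (simp add: initial_def)
next
  case (Suc s)
  then obtain P Q where IH:
    "fold (rsk_step A) (enumerate 1 (take s v)) (Map.empty, Map.empty) = (P, Q)" "tableau P"
    "\<And>j. j \<le> length ws \<Longrightarrow> initial P j = cells (stage j) s"
    "\<And>c i. Q c = Some i \<longleftrightarrow> (\<exists>t < s. stage (length ws) t = Some c \<and> i = Suc t)"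
    by auto
  have s: "s < length v" and x: "v ! s \<in> L" using Suc.prems word by auto
  obtain P' c where ins: "insert_line A P (v ! s) 1 = (P', c)" by (cases "insert_line A P (v ! s) 1")
  have "fits P (v ! s) 1"
    using line_end_ex[OF tableauD(3)[OF IH(2) x], of "v ! s" 1] unfolding fits_def by auto
  from insert_line_grows[OF IH(2) x this ins]
  have P': "tableau P'" "c \<notin> dom P" "dom P' = insert c (dom P)"
    "\<And>w. w \<in> L \<Longrightarrow> grows_from P P' (v ! s) 1 w" by auto
  have init: "\<And>j. j \<le> length ws \<Longrightarrow> initial P' j = cells (stage j) (Suc s)"
    using stage_step[OF IH(2) P'(1) s IH(3) P'(4)] by blast
  have "cells (stage (length ws)) s = dom P"
    "cells (stage (length ws)) (Suc s) = insert c (dom P)"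
    using init[of "length ws"] IH(3)[of "length ws"] initial_dom P' IH(2) by auto
  then have c: "stage (length ws) s = Some c"
    using P'(2) cells_Suc_insertD by metis
  have notin: "c \<notin> cells (stage (length ws)) s"
    using P'(2) \<open>cells (stage (length ws)) s = dom P\<close> by simp
  have "(Q(c \<mapsto> Suc s)) c' = Some i \<longleftrightarrow>
      (\<exists>t < Suc s. stage (length ws) t = Some c' \<and> i = Suc t)" for c' i
    using IH(4)[of c' i] c notin by (auto simp: less_Suc_eq cells_def)
  moreover have "fold (rsk_step A) (enumerate 1 (take (Suc s) v)) (Map.empty, Map.empty) =
      (P', Q(c \<mapsto> Suc s))"
    using IH(1) ins s
    by (simp add: take_Suc_conv_app_nth enumerate_append_eq rsk_insert_def)
  ultimately show ?case using P'(1) init by blast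
qed

lemma rsk_eq:
  assumes "rsk A v = (P, Q)"
  shows "dom P = cells (fold (level v) ws (\<lambda>_. None)) (length v)"
    and "Q c = Some i \<longleftrightarrow> (\<exists>t < length v. fold (level v) ws (\<lambda>_. None) t = Some c \<and> i = Suc t)"
proof -
  obtain P' Q' where *: "rsk A v = (P', Q')" "tableau P'"
    "\<forall>j \<le> length ws. initial P' j = cells (stage j) (length v)"
    "\<And>c i. Q' c = Some i \<longleftrightarrow> (\<exists>t < length v. stage (length ws) t = Some c \<and> i = Suc t)"
    using rsk_take[of "length v"] unfolding rsk_def by auto
  have PQ: "P' = P" "Q' = Q" using *(1) assms by auto
  have final: "stage (length ws) = fold (level v) ws (\<lambda>_. None)"
    by (simp add: stage_def)
  show "dom P = cells (fold (level v) ws (\<lambda>_. None)) (length v)"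
    using *(3) initial_dom[OF *(2)] unfolding PQ final[symmetric] by simp
  show "Q c = Some i \<longleftrightarrow> (\<exists>t < length v. fold (level v) ws (\<lambda>_. None) t = Some c \<and> i = Suc t)"
    using *(4) unfolding PQ final[symmetric] by simp
qed

end

theorem theorem2:
  fixes k l n :: nat and v :: "letter list"
    and A B :: "(letter \<times> letter) set"
    and P\<^sub>A P\<^sub>B :: "letter filling" and Q\<^sub>A Q\<^sub>B :: "nat filling"
  assumes "k + l > 0" and "n \<ge> 1"
    and "v \<in> words k l n"
    and "A \<in> shuffle_orders k l" and "B \<in> shuffle_orders k l"
    and "rsk A v = (P\<^sub>A, Q\<^sub>A)" and "rsk B v = (P\<^sub>B, Q\<^sub>B)"
  shows "sh P\<^sub>A = sh P\<^sub>B \<and> Q\<^sub>A = Q\<^sub>B"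
proof -
  define L where "L = letters k l"
  have word: "set v \<subseteq> L" using assms(3) by (simp add: words_def L_def)
  have order: "letter_order L C" if "C \<in> shuffle_orders k l" for C
    using that unfolding letter_order_def shuffle_orders_def L_def by (auto simp: letters_def)
  \<comment> \<open>A shuffle orders the letters of one kind by index; the converse follows by
    comparing indices.\<close>
  have less: "i < j" if "C \<in> shuffle_orders k l" "f = T \<and> S = {1..k} \<or> f = U \<and> S = {1..l}"
    "i \<in> S" "j \<in> S" "(f i, f j) \<in> C" for C f S i j
  proof (rule ccontr)
    interpret letter_order L C using order that(1) by blast
    assume "\<not> i < j"
    then have "i = j \<or> j < i" by linarith
    then have "i = j \<or> (f j, f i) \<in> C" using that unfolding shuffle_orders_def by auto
    then show False using that(5) trans irrefl by blast
  qed
  obtain xs ys where xs: "sorted_wrt (\<lambda>x y. (x, y) \<in> A) xs" "set xs = L"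
    and ys: "sorted_wrt (\<lambda>x y. (x, y) \<in> B) ys" "set ys = L"
    using letter_order.sorted_enumeration order assms(4,5) by metis
  have T: "{w \<in> L. is_T w} = T ` {1..k}" and U: "{w \<in> L. \<not> is_T w} = U ` {1..l}"
    by (auto simp: L_def letters_def)
  have sorted: "sorted_wrt (\<lambda>x y. (x, y) \<in> A) (filter p xs)"
    "sorted_wrt (\<lambda>x y. (x, y) \<in> B) (filter p ys)" for p
    using xs ys sorted_wrt_filter by blast+
  have "inj T" "inj U" by (simp_all add: inj_def)
  have Ts: "filter is_T xs = filter is_T ys"
  proof (rule sorted_enumeration_unique[OF sorted(1) _ sorted(2) _ \<open>inj T\<close>])
    show "set (filter is_T xs) = T ` {1..k}" "set (filter is_T ys) = T ` {1..k}"
      using xs ys T by auto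
  qed (use less[where f = T and S = "{1..k}"] assms(4,5) in blast)+
  have Us: "filter (\<lambda>w. \<not> is_T w) xs = filter (\<lambda>w. \<not> is_T w) ys"
  proof (rule sorted_enumeration_unique[OF sorted(1) _ sorted(2) _ \<open>inj U\<close>])
    show "set (filter (\<lambda>w. \<not> is_T w) xs) = U ` {1..l}"
      "set (filter (\<lambda>w. \<not> is_T w) ys) = U ` {1..l}"
      using xs ys U by auto
  qed (use less[where f = U and S = "{1..l}"] assms(4,5) in blast)+
  interpret A: sorted_letters L A xs v
    using order[OF assms(4)] xs word by (simp add: sorted_letters_def sorted_letters_axioms_def)
  interpret B: sorted_letters L B ys v
    using order[OF assms(5)] ys word by (simp add: sorted_letters_def sorted_letters_axioms_def)
  \<comment> \<open>The two sorted alphabets differ only in how t-letters and u-letters are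
    interleaved, and separation by kind removes this difference.\<close>
  have eq: "fold (level v) xs (\<lambda>_. None) = fold (level v) ys (\<lambda>_. None)"
    using fold_level_separate[OF valid_None A.distinct_ws, of v]
      fold_level_separate[OF valid_None B.distinct_ws, of v] Ts Us by simp
  have "Q\<^sub>A c = Some i \<longleftrightarrow> Q\<^sub>B c = Some i" for c i
    using A.rsk_eq(2)[OF assms(6)] B.rsk_eq(2)[OF assms(7)] eq by simp
  then have "Q\<^sub>A = Q\<^sub>B" by (intro ext) (metis option.exhaust)
  then show ?thesis
    using A.rsk_eq(1)[OF assms(6)] B.rsk_eq(1)[OF assms(7)] eq by (simp add: sh_def)
qed

end
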